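(* Let $X,Y$ be non-trivial complex Banach spaces and let $I=\mathbb{R}$ or $I=[0,\infty)$. Suppose that $p,q\in[1,\infty)$, $r\in[1,\infty]$, $1/p=1/q+1/r$ and the following conditions hold: (i) $f\in APS^{p}(I\times Y:X)$ and there exists a function $L_f\in L_S^{r}(I)$ such that $$\|f(t,x)-f(t,y)\|\le L_f(t)\,\|x-y\|_Y,\qquad t\in I,\ x,y\in Y.$$ (ii) $x\in APS^{q}(I:Y)$, and there exists a set $E\subseteq I$ of Lebesgue measure $0$ such that $K:=\{x(t): t\in I\setminus E\}$ is relatively compact in $Y$. Then $f(\cdot,x(\cdot))\in APS^{p}(I:X)$.
   Context: Let $Z$ denote an arbitrary complex Banach space. **Almost periodic functions.** A continuous function $f:I\to Z$ is almost periodic if for every $\epsilon>0$ there is $l>0$ such that every subinterval of $I$ of length $l$ contains a number $\tau$ with $\|f(t+\tau)-f(t)\|\le\epsilon$ for all $t\in I$. **Stepanov bounded functions.** For $1\le p<\infty$, $L_S^{p}(I:Z)$ is the space of all $f\in L^p_{loc}(I:Z)$ with $\|f\|_{S^p}:=\sup_{t\in I}\left(\int_t^{t+1}\|f(s)\|^p\,ds\right)^{1/p}<\infty$. For $p=\infty$, $L_S^{\infty}(I:Z):=L^\infty(I:Z)$. Put $L_S^{r}(I):=L_S^{r}(I:\mathbb{C})$ for $r\in[1,\infty]$. **Stepanov almost periodic functions.** For $1\le p<\infty$, a function $f\in L_S^{p}(I:Z)$ is Stepanov $p$-almost periodic, $f\in APS^{p}(I:Z)$, if the function $\hat f:I\to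 L^p([0,1]:Z)$, $\hat f(t)(s):=f(t+s)$ ($t\in I$, $s\in[0,1]$), is almost periodic. **Two-parameter functions.** A function $F:I\times Y\to Z$ is almost periodic if it is bounded, continuous, and for every $\epsilon>0$ and every compact $K\subseteq Y$ there is $l(\epsilon,K)>0$ such that every subinterval $J\subseteq I$ of length $l(\epsilon,K)$ contains a number $\tau$ with $\|F(t+\tau,y)-F(t,y)\|\le\epsilon$ for all $t\in I$, $y\in K$. A function $f:I\times Y\to X$ belongs to $APS^{p}(I\times Y:X)$ (is Stepanov $p$-almost periodic) if $\hat f:I\times Y\to L^p([0,1]:X)$, $\hat f(t,y):=f(t+\cdot,y)$, is almost periodic in this sense. *)

theory Defs
  imports "HOL-Analysis.Analysis"
begin

text \<open>The distribution only has real Banach spaces; a complex one is a real one carrying a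
  compatible multiplication by complex scalars for which the norm is homogeneous.\<close>

class complex_banach = banach +
  fixes scaleC :: "complex \<Rightarrow> 'a \<Rightarrow> 'a"  (infixr \<open>*\<^sub>C\<close> 75)
  assumes scaleC_add_right: "a *\<^sub>C (x + y) = a *\<^sub>C x + a *\<^sub>C y"
    and scaleC_add_left: "(a + b) *\<^sub>C x = a *\<^sub>C x + b *\<^sub>C x"
    and scaleC_scaleC: "a *\<^sub>C (b *\<^sub>C x) = (a * b) *\<^sub>C x"
    and scaleC_of_real: "complex_of_real r *\<^sub>C x = r *\<^sub>R x"
    and norm_scaleC: "norm (a *\<^sub>C x) = cmod a * norm x"

instantiation complex :: complex_banach
begin

definition scaleC_complex :: "complex \<Rightarrow> complex \<Rightarrow> complex" where
  "scaleC_complex a x = a * x"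

instance
  by standard (simp_all add: scaleC_complex_def algebra_simps norm_mult scaleR_conv_of_real)

end

text \<open>Strong (Bochner) measurability. Borel measurability would be too weak, since the spaces are
  not assumed to be separable; for the same reason the Bochner integral of the library, which
  is restricted to second countable spaces, is only applied to norms.\<close>

definition strongly_measurable_on :: "real set \<Rightarrow> (real \<Rightarrow> 'a::real_normed_vector) \<Rightarrow> bool" where
  "strongly_measurable_on S f \<longleftrightarrow>
     (\<exists>u. (\<forall>n. simple_function (lebesgue_on S) (u n)) \<and>
          (AE s in lebesgue_on S. (\<lambda>n. u n s) \<longlonglongrightarrow> f s))"

text \<open>Elements of Lebesgue spaces are represented by functions, not by classes modulo equality
  almost everywhere; accordingly \<open>Lp_norm\<close> is a seminorm, meaningful only on \<open>Lp_space\<close>.\<close>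

definition Lp_space :: "real \<Rightarrow> real set \<Rightarrow> (real \<Rightarrow> 'a::real_normed_vector) set" where
  "Lp_space p S =
     {f. strongly_measurable_on S f \<and> integrable (lebesgue_on S) (\<lambda>s. norm (f s) powr p)}"

definition Lp_norm :: "real \<Rightarrow> real set \<Rightarrow> (real \<Rightarrow> 'a::real_normed_vector) \<Rightarrow> real" where
  "Lp_norm p S f = (LINT s|lebesgue_on S. norm (f s) powr p) powr (1 / p)"

definition Lp_loc :: "real \<Rightarrow> real set \<Rightarrow> (real \<Rightarrow> 'a::real_normed_vector) set" where
  "Lp_loc p I = {f. \<forall>C. compact C \<and> C \<subseteq> I \<longrightarrow> f \<in> Lp_space p C}"

definition Linf_space :: "real set \<Rightarrow> (real \<Rightarrow> 'a::real_normed_vector) set" where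
  "Linf_space S =
     {f. strongly_measurable_on S f \<and> (\<exists>B. AE s in lebesgue_on S. norm (f s) \<le> B)}"

definition stepanov_norm :: "real \<Rightarrow> real set \<Rightarrow> (real \<Rightarrow> 'a::real_normed_vector) \<Rightarrow> ereal" where
  "stepanov_norm p I f = (SUP t\<in>I. ereal (Lp_norm p {t..t+1} f))"

definition stepanov_space :: "ereal \<Rightarrow> real set \<Rightarrow> (real \<Rightarrow> 'a::real_normed_vector) set" where
  "stepanov_space r I =
     (if r = \<infinity> then Linf_space I
      else {f \<in> Lp_loc (real_of_ereal r) I. stepanov_norm (real_of_ereal r) I f < \<infinity>})"

text \<open>Almost periodicity is defined relative to a (semi)norm \<open>N\<close> on the target space, so that
  it applies to functions with values in \<open>Lp_space p {0..1}\<close>, where differences of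
  representatives are pointwise differences of functions.\<close>

definition continuous_wrt ::
    "('b::minus \<Rightarrow> real) \<Rightarrow> 'a::topological_space set \<Rightarrow> ('a \<Rightarrow> 'b) \<Rightarrow> bool" where
  "continuous_wrt N S g \<longleftrightarrow> (\<forall>a\<in>S. ((\<lambda>u. N (g u - g a)) \<longlongrightarrow> 0) (at a within S))"

definition almost_periodic :: "('b::minus \<Rightarrow> real) \<Rightarrow> real set \<Rightarrow> (real \<Rightarrow> 'b) \<Rightarrow> bool" where
  "almost_periodic N I g \<longleftrightarrow>
     continuous_wrt N I g \<and>
     (\<forall>\<epsilon>>0. \<exists>l>0. \<forall>a. {a..a+l} \<subseteq> I \<longrightarrow>
        (\<exists>\<tau>\<in>{a..a+l}. \<forall>t\<in>I. N (g (t + \<tau>) - g t) \<le> \<epsilon>))"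

definition almost_periodic2 ::
    "('b::minus \<Rightarrow> real) \<Rightarrow> real set \<Rightarrow> (real \<Rightarrow> 'y::topological_space \<Rightarrow> 'b) \<Rightarrow> bool" where
  "almost_periodic2 N I F \<longleftrightarrow>
     (\<exists>B. \<forall>t\<in>I. \<forall>y. N (F t y) \<le> B) \<and>
     continuous_wrt N (I \<times> UNIV) (\<lambda>(t, y). F t y) \<and>
     (\<forall>\<epsilon>>0. \<forall>K. compact K \<longrightarrow>
        (\<exists>l>0. \<forall>a. {a..a+l} \<subseteq> I \<longrightarrow>
          (\<exists>\<tau>\<in>{a..a+l}. \<forall>t\<in>I. \<forall>y\<in>K. N (F (t + \<tau>) y - F t y) \<le> \<epsilon>)))"

definition bochner_transform :: "(real \<Rightarrow> 'a) \<Rightarrow> real \<Rightarrow> real \<Rightarrow> 'a" where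
  "bochner_transform f t = (\<lambda>s. f (t + s))"

definition APS :: "real \<Rightarrow> real set \<Rightarrow> (real \<Rightarrow> 'a::real_normed_vector) set" where
  "APS p I =
     {f \<in> stepanov_space (ereal p) I.
        almost_periodic (Lp_norm p {0..1}) I (bochner_transform f)}"

text \<open>The first condition says that the two-parameter transform takes values in
  \<open>Lp_space p {0..1}\<close>; for \<open>APS\<close> this is contained in Stepanov boundedness.\<close>

definition APS2 ::
    "real \<Rightarrow> real set \<Rightarrow> (real \<Rightarrow> 'y::topological_space \<Rightarrow> 'a::real_normed_vector) set" where
  "APS2 p I =
     {f. (\<forall>t\<in>I. \<forall>y. bochner_transform (\<lambda>s. f s y) t \<in> Lp_space p {0..1}) \<and>
         almost_periodic2 (Lp_norm p {0..1}) I (\<lambda>t y. bochner_transform (\<lambda>s. f s y) t)}"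

end

theory Submission
  imports Defs
begin

text \<open>Write \<open>h t = f t (x t)\<close>. The Lipschitz condition splits the difference of \<open>h\<close> at two points \<open>u\<close>, \<open>v\<close>
  into a part bounded by \<open>L u * norm (x u - x v)\<close> and the difference of \<open>f u\<close> and \<open>f v\<close> at the point \<open>x v\<close>. In the mean
  over unit intervals the first part is small when \<open>x\<close> hardly changes from \<open>u\<close> to \<open>v\<close>, by Hoelder's
  inequality. For the second part, \<open>x v\<close> lies in a compact set \<open>K\<close> for almost all \<open>v\<close>; up to errors
  \<open>L u * \<rho>\<close> and \<open>L v * \<rho>\<close> it can be replaced by a point of a finite \<open>\<rho>\<close>-net of \<open>K\<close>, and the section
  of \<open>f\<close> at each point of the net hardly changes from \<open>u\<close> to \<open>v\<close>. So the transform of \<open>h\<close> changes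
  little whenever that of \<open>x\<close> and those of finitely many sections of \<open>f\<close> do; this is
  \<open>gauge_h_small\<close>, and it yields both the continuity of the transform and its almost periods.

  For the almost periods, those of \<open>f\<close> and of \<open>x\<close> have to be found simultaneously. That two almost
  periodic functions have a relatively dense set of common almost periods is a theorem of Bohr;
  \<open>common_periods\<close> proves it in a form that covers the line and the half-line.

  Two devices keep the analysis elementary. Integrals of powers \<open>norm _ powr p\<close> replace the seminorms;
  they satisfy the triangle inequality up to a constant, which is all that almost periodicity requires.
  And \<open>stepanov_multiplier_weight\<close> uses Young's inequality with a small coefficient instead of Hoelder's,
  which removes the distinction between finite and infinite \<open>r\<close>. It remains to see that \<open>h\<close> is strongly
  measurable, in spaces that may fail to be separable (\<open>strongly_measurable_on_superposition\<close>), and that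
  it is Stepanov bounded (\<open>h_stepanov\<close>), which follows by comparing \<open>f t (x t)\<close> with \<open>f t 0\<close>.\<close>

section \<open>Common almost periods\<close>

text \<open>Almost periodicity of a map into a seminormed space only involves the distances
  \<open>D u v\<close> between its values at \<open>u\<close> and \<open>v\<close>. It is axiomatized for such gauges, because a gauge
  may measure several maps at once and may be a \<open>p\<close>-th power of a seminorm; the constant \<open>c\<close> in
  the triangle inequality pays for the power.\<close>

locale almost_periodic_gauge =
  fixes I :: "real set" and c :: real and D :: "real \<Rightarrow> real \<Rightarrow> real"
  assumes I_cases: "I = UNIV \<or> I = {0..}"
    and c_ge_1: "1 \<le> c"
    and refl: "u \<in> I \<Longrightarrow> D u u = 0"
    and sym: "u \<in> I \<Longrightarrow> v \<in> I \<Longrightarrow> D u v = D v u"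
    and quasi_triangle: "u \<in> I \<Longrightarrow> v \<in> I \<Longrightarrow> w \<in> I \<Longrightarrow> D u w \<le> c * (D u v + D v w)"
    and continuous: "a \<in> I \<Longrightarrow> ((\<lambda>u. D u a) \<longlongrightarrow> 0) (at a within I)"
    and periods: "0 < \<epsilon> \<Longrightarrow> \<exists>l>0. \<forall>a. {a..a+l} \<subseteq> I \<longrightarrow> (\<exists>\<tau>\<in>{a..a+l}. \<forall>t\<in>I. D (t + \<tau>) t \<le> \<epsilon>)"
begin

lemma add_closed: "u \<in> I \<Longrightarrow> v \<in> I \<Longrightarrow> u + v \<in> I"
  using I_cases by auto

lemma uniformly_continuous_on_compact:
  assumes C: "compact C" "C \<subseteq> I" and "0 < \<epsilon>"
  obtains \<delta> where "0 < \<delta>" "\<And>u v. u \<in> C \<Longrightarrow> v \<in> C \<Longrightarrow> \<bar>u - v\<bar> < \<delta> \<Longrightarrow> D u v \<le> \<epsilon>"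
proof -
  define e where "e = \<epsilon> / (2 * c)"
  have c0: "0 < c" using c_ge_1 by simp
  have e: "0 < e" using c0 \<open>0 < \<epsilon>\<close> by (simp add: e_def)
  have "\<exists>\<eta>>0. \<forall>u\<in>I. \<bar>u - a\<bar> < \<eta> \<longrightarrow> D u a < e" if "a \<in> I" for a
  proof -
    have "\<forall>\<^sub>F u in at a within I. D u a < e"
      using order_tendstoD(2)[OF continuous[OF that] e] .
    then obtain \<eta> where "\<eta> > 0" "\<forall>u\<in>I. u \<noteq> a \<and> dist u a < \<eta> \<longrightarrow> D u a < e"
      unfolding eventually_at by blast
    then show ?thesis using refl[OF that] e by (intro exI[of _ \<eta>]) (force simp: dist_real_def)
  qed
  then obtain \<eta> where \<eta>: "\<And>a. a \<in> I \<Longrightarrow> 0 < \<eta> a"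
      "\<And>a u. a \<in> I \<Longrightarrow> u \<in> I \<Longrightarrow> \<bar>u - a\<bar> < \<eta> a \<Longrightarrow> D u a < e"
    by metis
  have "C \<subseteq> \<Union>((\<lambda>a. ball a (\<eta> a)) ` C)" using C \<eta>(1) by force
  then obtain \<delta> where \<delta>: "0 < \<delta>" "\<And>u. u \<in> C \<Longrightarrow> \<exists>G\<in>(\<lambda>a. ball a (\<eta> a)) ` C. ball u \<delta> \<subseteq> G"
    by (rule Heine_Borel_lemma[OF C(1)]) auto
  show thesis
  proof (rule that[OF \<delta>(1)])
    fix u v assume uv: "u \<in> C" "v \<in> C" "\<bar>u - v\<bar> < \<delta>"
    obtain a where a: "a \<in> C" "ball u \<delta> \<subseteq> ball a (\<eta> a)" using \<delta>(2)[OF uv(1)] by auto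
    have "u \<in> ball a (\<eta> a)" "v \<in> ball a (\<eta> a)"
      using a(2) \<delta>(1) uv(3) by (auto simp: dist_real_def subset_iff)
    then have "D u a < e" "D v a < e"
      using \<eta>(2) a C uv by (auto simp: dist_real_def abs_minus_commute subset_iff)
    moreover have "D u v \<le> c * (D u a + D a v)" using quasi_triangle uv a C by blast
    moreover have "D a v = D v a" using sym uv a C by blast
    ultimately have "D u v \<le> c * (e + e)"
      using c0 by (smt (verit) mult_left_mono)
    then show "D u v \<le> \<epsilon>" using c0 by (simp add: e_def)
  qed
qed

text \<open>Points \<open>u\<close>, \<open>v\<close> that are close together can be moved into a fixed compact interval by one common
  almost period \<open>\<tau>\<close>, at the cost of two applications of the triangle inequality. On the half-line
  the shifted points must not become negative; this only obstructs the argument for \<open>u\<close> so small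
  that the points already lie in the compact interval.\<close>

lemma uniformly_continuous:
  assumes "0 < \<epsilon>"
  obtains \<delta> where "0 < \<delta>" "\<And>u v. u \<in> I \<Longrightarrow> v \<in> I \<Longrightarrow> \<bar>u - v\<bar> < \<delta> \<Longrightarrow> D u v \<le> \<epsilon>"
proof -
  define e where "e = \<epsilon> / (3 * c * c)"
  have c0: "0 < c" using c_ge_1 by simp
  have e: "0 < e" using c0 assms by (simp add: e_def)
  obtain l where l: "0 < l"
    "\<And>a. {a..a+l} \<subseteq> I \<Longrightarrow> \<exists>\<tau>\<in>{a..a+l}. \<forall>t\<in>I. D (t + \<tau>) t \<le> e"
    using periods[OF e] by blast
  have C: "compact {0..l+2}" "{0..l+2} \<subseteq> I" using I_cases by auto
  obtain \<delta> where \<delta>: "0 < \<delta>"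
    "\<And>u v. u \<in> {0..l+2} \<Longrightarrow> v \<in> {0..l+2} \<Longrightarrow> \<bar>u - v\<bar> < \<delta> \<Longrightarrow> D u v \<le> e"
    using uniformly_continuous_on_compact[OF C e] by blast
  have "e \<le> \<epsilon>"
  proof -
    have "1 \<le> c * c" using c_ge_1 mult_mono[of 1 c 1 c] by simp
    then have "\<epsilon> * 1 \<le> \<epsilon> * (3 * c * c)" using assms by (intro mult_left_mono) auto
    then show ?thesis using c0 by (simp add: e_def field_simps)
  qed
  show thesis
  proof (rule that[of "min \<delta> 1"])
    show "0 < min \<delta> 1" using \<delta> by simp
    fix u v assume uv: "u \<in> I" "v \<in> I" "\<bar>u - v\<bar> < min \<delta> 1"
    show "D u v \<le> \<epsilon>"
    proof (cases "{u-l-1..u-1} \<subseteq> I")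
      case True
      obtain \<tau> where \<tau>: "\<tau> \<in> {u-l-1..u-1}" "\<forall>t\<in>I. D (t + \<tau>) t \<le> e"
        using l(2)[of "u-l-1"] True by auto
      \<comment> \<open>\<open>\<tau>\<close> stops at \<open>u - 1\<close>, hence \<open>s \<ge> 1\<close>, and \<open>t\<close>, at distance below 1 from \<open>s\<close>, stays in \<open>I\<close>.\<close>
      define s t where "s = u - \<tau>" and "t = v - \<tau>"
      have st: "s \<in> {0..l+2}" "t \<in> {0..l+2}" "u = s + \<tau>" "v = t + \<tau>"
        using \<tau>(1) uv(3) by (auto simp: s_def t_def)
      have I: "s \<in> I" "t \<in> I" using st C by auto
      have *: "D u s \<le> e" "D v t \<le> e" using \<tau>(2) I st by auto
      have "D s v \<le> c * (D s t + D t v)" using quasi_triangle I uv by blast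
      also have "\<dots> \<le> c * (e + e)"
        using \<delta>(2)[OF st(1,2)] uv(3) * sym I uv c0
        by (intro mult_left_mono add_mono) (auto simp: s_def t_def)
      finally have "D s v \<le> 2 * c * e" by simp
      have "D u v \<le> c * (D u s + D s v)" using quasi_triangle I uv by blast
      also have "\<dots> \<le> c * (c * e + 2 * c * e)"
      proof (intro mult_left_mono add_mono)
        show "D u s \<le> c * e" using * c_ge_1 e by (smt (verit) mult_le_cancel_right1)
      qed (use \<open>D s v \<le> 2 * c * e\<close> c0 in auto)
      also have "\<dots> = \<epsilon>" using c0 by (simp add: e_def field_simps)
      finally show ?thesis .
    next
      case False
      then have "I = {0..}" "u < l + 1" using I_cases by auto
      then have "u \<in> {0..l+2}" "v \<in> {0..l+2}" using uv by auto
      then show ?thesis using \<delta>(2) uv \<open>e \<le> \<epsilon>\<close> by (meson min_less_iff_conj order_trans)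
    qed
  qed
qed

end

text \<open>Two gauges have a relatively dense set of common almost periods. This is Bohr's argument. In every
  window \<open>{a..a+l}\<close> there are an almost period \<open>\<tau> a\<close> of \<open>D\<close> and an almost period \<open>\<sigma> a\<close> of \<open>D'\<close>. Their
  differences lie in \<open>{-l..l}\<close>, which is covered by finitely many cells of length \<open>\<delta>\<close>, so finitely many
  windows \<open>R\<close> represent all cells. If the window at \<open>a\<close> has the same cell as \<open>r \<in> R\<close>, then
  \<open>\<tau> a - \<tau> r\<close> differs from \<open>\<sigma> a - \<sigma> r\<close> by less than \<open>\<delta>\<close>: it is a difference of almost periods
  of \<open>D\<close> and, up to a shift that uniform continuity makes harmless, of \<open>D'\<close>.\<close>

lemma common_periods:
  assumes "almost_periodic_gauge I c D" "almost_periodic_gauge I c' D'" and "0 < \<epsilon>"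
  shows "\<exists>l>0. \<forall>a. {a..a+l} \<subseteq> I \<longrightarrow>
    (\<exists>\<omega>\<in>{a..a+l}. \<forall>t\<in>I. D (t + \<omega>) t \<le> \<epsilon> \<and> D' (t + \<omega>) t \<le> \<epsilon>)"
proof -
  interpret D: almost_periodic_gauge I c D by fact
  interpret D': almost_periodic_gauge I c' D' by fact
  have c0: "0 < c" "0 < c'" using D.c_ge_1 D'.c_ge_1 by auto
  define e where "e = min (\<epsilon> / (2 * c)) (\<epsilon> / (3 * c' * c'))"
  have e: "0 < e" "2 * c * e \<le> \<epsilon>" "3 * c' * c' * e \<le> \<epsilon>"
  proof -
    show "0 < e" using c0 assms(3) by (simp add: e_def)
    have "e \<le> \<epsilon> / (2 * c)" "e \<le> \<epsilon> / (3 * c' * c')" by (simp_all add: e_def)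
    then show "2 * c * e \<le> \<epsilon>" "3 * c' * c' * e \<le> \<epsilon>" using c0 by (simp_all add: field_simps)
  qed
  obtain \<delta> where \<delta>: "0 < \<delta>" "\<And>u v. u \<in> I \<Longrightarrow> v \<in> I \<Longrightarrow> \<bar>u - v\<bar> < \<delta> \<Longrightarrow> D' u v \<le> e"
    using D'.uniformly_continuous[OF e(1)] by blast
  obtain l1 where l1: "0 < l1"
    "\<And>a. {a..a+l1} \<subseteq> I \<Longrightarrow> \<exists>\<tau>\<in>{a..a+l1}. \<forall>t\<in>I. D (t + \<tau>) t \<le> e"
    using D.periods[OF e(1)] by blast
  obtain l2 where l2: "0 < l2"
    "\<And>a. {a..a+l2} \<subseteq> I \<Longrightarrow> \<exists>\<tau>\<in>{a..a+l2}. \<forall>t\<in>I. D' (t + \<tau>) t \<le> e"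
    using D'.periods[OF e(1)] by blast
  define l where "l = max l1 l2"
  have l: "0 < l" using l1 by (simp add: l_def)
  define A where "A = {a. {a..a+l} \<subseteq> I}"
  have AI: "a \<in> A \<longleftrightarrow> a \<in> I" for a using D.I_cases l by (auto simp: A_def)
  have "\<exists>\<tau>\<in>{a..a+l}. \<forall>t\<in>I. D (t + \<tau>) t \<le> e" if "a \<in> A" for a
    using l1(2)[of a] that by (force simp: A_def l_def)
  then obtain \<tau> where \<tau>: "\<And>a. a \<in> A \<Longrightarrow> \<tau> a \<in> {a..a+l}"
    "\<And>a t. a \<in> A \<Longrightarrow> t \<in> I \<Longrightarrow> D (t + \<tau> a) t \<le> e" by metis
  have "\<exists>\<sigma>\<in>{a..a+l}. \<forall>t\<in>I. D' (t + \<sigma>) t \<le> e" if "a \<in> A" for a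
    using l2(2)[of a] that by (force simp: A_def l_def)
  then obtain \<sigma> where \<sigma>: "\<And>a. a \<in> A \<Longrightarrow> \<sigma> a \<in> {a..a+l}"
    "\<And>a t. a \<in> A \<Longrightarrow> t \<in> I \<Longrightarrow> D' (t + \<sigma> a) t \<le> e" by metis
  define cell where "cell a = \<lfloor>(\<tau> a - \<sigma> a) / \<delta>\<rfloor>" for a
  have "cell ` A \<subseteq> {\<lfloor>- l / \<delta>\<rfloor>..\<lfloor>l / \<delta>\<rfloor>}"
  proof clarify
    fix a assume "a \<in> A"
    then have "- l \<le> \<tau> a - \<sigma> a" "\<tau> a - \<sigma> a \<le> l" using \<tau>(1)[of a] \<sigma>(1)[of a] by auto
    then have "- l / \<delta> \<le> (\<tau> a - \<sigma> a) / \<delta>" "(\<tau> a - \<sigma> a) / \<delta> \<le> l / \<delta>"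
      using \<delta>(1) by (intro divide_right_mono; simp)+
    then show "cell a \<in> {\<lfloor>- l / \<delta>\<rfloor>..\<lfloor>l / \<delta>\<rfloor>}" by (auto simp: cell_def intro: floor_mono)
  qed
  then have "finite (cell ` A)" by (rule finite_subset) simp
  then obtain R where R: "R \<subseteq> A" "finite R" "cell ` A = cell ` R"
    using finite_subset_image[of "cell ` A" cell A] by auto
  define M where "M = (\<Sum>r\<in>R. \<bar>\<tau> r\<bar>)"
  have M: "\<bar>\<tau> r\<bar> \<le> M" if "r \<in> R" for r
    unfolding M_def using R(2) that by (intro member_le_sum) auto
  have M0: "0 \<le> M" unfolding M_def by (intro sum_nonneg) auto
  show ?thesis
  proof (intro exI[of _ "l + 2 * M"] conjI allI impI)
    show "0 < l + 2 * M" using l M0 by simp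
    fix b assume b: "{b..b + (l + 2 * M)} \<subseteq> I"
    \<comment> \<open>Starting at \<open>b + M\<close> leaves room for subtracting any \<open>\<tau> r\<close> without leaving the target window,
      so \<open>\<omega>\<close> is in \<open>I\<close>.\<close>
    have a: "b + M \<in> A" using b l M0 by (auto simp: A_def subset_iff)
    then obtain r where r: "r \<in> R" "cell (b + M) = cell r" using R(3) by blast
    have rA: "r \<in> A" using r R by blast
    define \<omega> where "\<omega> = \<tau> (b + M) - \<tau> r"
    have \<omega>: "\<omega> \<in> {b..b + (l + 2 * M)}"
      using \<tau>(1)[OF a] M[OF r(1)] by (auto simp: \<omega>_def)
    then have \<omega>I: "\<omega> \<in> I" using b by blast
    have \<tau>I: "\<tau> a \<in> I" "\<sigma> a \<in> I" if "a \<in> A" for a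
      using that \<tau>(1)[OF that] \<sigma>(1)[OF that] unfolding A_def by blast+
    have close: "\<bar>(\<tau> (b + M) - \<sigma> (b + M)) - (\<tau> r - \<sigma> r)\<bar> < \<delta>"
    proof -
      have "\<bar>(\<tau> (b + M) - \<sigma> (b + M)) / \<delta> - (\<tau> r - \<sigma> r) / \<delta>\<bar> < 1"
        using r(2) unfolding cell_def by linarith
      then have "\<bar>((\<tau> (b + M) - \<sigma> (b + M)) - (\<tau> r - \<sigma> r)) / \<delta>\<bar> < 1"
        by (simp add: diff_divide_distrib)
      then show ?thesis using \<delta>(1) by (simp add: abs_divide)
    qed
    show "\<exists>\<omega>\<in>{b..b + (l + 2 * M)}. \<forall>t\<in>I. D (t + \<omega>) t \<le> \<epsilon> \<and> D' (t + \<omega>) t \<le> \<epsilon>"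
    proof (intro bexI[of _ \<omega>] ballI conjI)
      fix t assume t: "t \<in> I"
      have t\<omega>: "t + \<omega> \<in> I" using D.add_closed t \<omega>I by blast
      \<comment> \<open>The passage from \<open>t + \<omega>\<close> to \<open>t\<close> goes upwards through \<open>t + \<tau> (b + M)\<close>, never through
        \<open>t - \<tau> r\<close>, which may be outside the half-line.\<close>
      have eq: "t + \<omega> + \<tau> r = t + \<tau> (b + M)" by (simp add: \<omega>_def)
      have in_I: "t + \<tau> (b + M) \<in> I" using D.add_closed t \<tau>I[OF a] by blast
      have "D (t + \<omega>) t \<le> c * (D (t + \<omega>) (t + \<tau> (b + M)) + D (t + \<tau> (b + M)) t)"
        using D.quasi_triangle t t\<omega> in_I by blast
      also have "\<dots> \<le> c * (e + e)"
        using \<tau>(2)[OF rA t\<omega>] \<tau>(2)[OF a t] D.sym t\<omega> in_I c0 eq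
        by (intro mult_left_mono add_mono) auto
      finally show "D (t + \<omega>) t \<le> \<epsilon>" using e by simp
      let ?u = "t + \<omega> + \<sigma> r" and ?v = "t + \<sigma> (b + M)"
      have uv: "?u \<in> I" "?v \<in> I" using D.add_closed t t\<omega> \<tau>I a rA by blast+
      have "\<bar>?u - ?v\<bar> < \<delta>" using close by (simp add: \<omega>_def algebra_simps)
      then have Duv: "D' ?u ?v \<le> e" using \<delta>(2) uv by blast
      have "D' (t + \<omega>) ?v \<le> c' * (D' (t + \<omega>) ?u + D' ?u ?v)"
        using D'.quasi_triangle t\<omega> uv by blast
      also have "\<dots> \<le> c' * (e + e)"
        using \<sigma>(2)[OF rA t\<omega>] Duv D'.sym t\<omega> uv c0 by (intro mult_left_mono add_mono) auto
      finally have *: "D' (t + \<omega>) ?v \<le> 2 * c' * e" by simp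
      have "D' (t + \<omega>) t \<le> c' * (D' (t + \<omega>) ?v + D' ?v t)"
        using D'.quasi_triangle t\<omega> uv t by blast
      also have "\<dots> \<le> c' * (2 * c' * e + c' * e)"
      proof (intro mult_left_mono add_mono)
        show "D' ?v t \<le> c' * e"
          using \<sigma>(2)[OF a t] D'.c_ge_1 e(1) by (smt (verit) mult_le_cancel_right1)
      qed (use * c0 in auto)
      also have "\<dots> = 3 * c' * c' * e" by (simp add: algebra_simps)
      finally show "D' (t + \<omega>) t \<le> \<epsilon>" using e by simp
    qed (rule \<omega>)
  qed
qed

section \<open>Strong measurability\<close>

text \<open>Completeness of Lebesgue measure makes limits that exist only almost everywhere measurable.\<close>

lemma borel_measurable_lebesgue_on_AE_limit:
  fixes u :: "nat \<Rightarrow> real \<Rightarrow> real"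
  assumes S: "S \<in> sets lebesgue"
    and u: "\<And>n. u n \<in> borel_measurable (lebesgue_on S)"
    and lim: "AE s in lebesgue_on S. (\<lambda>n. u n s) \<longlonglongrightarrow> g s"
  shows "g \<in> borel_measurable (lebesgue_on S)"
proof -
  define h where "h s = lim (\<lambda>n. u n s)" for s
  have h: "h \<in> borel_measurable (lebesgue_on S)"
    unfolding h_def using u by (rule borel_measurable_lim_metric)
  have "AE s in lebesgue_on S. h s = g s"
    using lim by eventually_elim (simp add: h_def limI)
  then have "AE s in lebesgue. (if s \<in> S then h s else 0) = (if s \<in> S then g s else 0)"
    using S by (auto simp: AE_restrict_space_iff elim: eventually_mono)
  from borel_measurable_AE[OF _ this]
  show ?thesis
    using h S by (simp add: borel_measurable_if_lebesgue_on borel_measurable_if)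
qed

text \<open>Approximants defined on the whole line allow one to change \<open>S\<close>: restriction, union and translation
  become operations on the approximants.\<close>

lemma strongly_measurable_on_iff:
  fixes f :: "real \<Rightarrow> 'a::real_normed_vector"
  assumes S: "S \<in> sets lebesgue"
  shows "strongly_measurable_on S f \<longleftrightarrow>
    (\<exists>u. (\<forall>n. simple_function lebesgue (u n)) \<and>
         (AE s in lebesgue. s \<in> S \<longrightarrow> (\<lambda>n. u n s) \<longlonglongrightarrow> f s))" (is "?L \<longleftrightarrow> ?R")
proof
  assume ?L
  then obtain u where u: "\<And>n. simple_function (lebesgue_on S) (u n)"
    "AE s in lebesgue. s \<in> S \<longrightarrow> (\<lambda>n. u n s) \<longlonglongrightarrow> f s"
    using S by (auto simp: strongly_measurable_on_def AE_restrict_space_iff)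
  have "\<forall>n. simple_function lebesgue (\<lambda>s. indicator S s *\<^sub>R u n s)"
    using u(1) S by (simp add: simple_function_restrict_space)
  moreover have "AE s in lebesgue. s \<in> S \<longrightarrow> (\<lambda>n. indicator S s *\<^sub>R u n s) \<longlonglongrightarrow> f s"
    using u(2) by eventually_elim simp
  ultimately show ?R by (intro exI[of _ "\<lambda>n s. indicator S s *\<^sub>R u n s"]) simp
next
  assume ?R
  then obtain u where u: "\<And>n. simple_function lebesgue (u n)"
    "AE s in lebesgue. s \<in> S \<longrightarrow> (\<lambda>n. u n s) \<longlonglongrightarrow> f s" by blast
  have "simple_function lebesgue (\<lambda>s. indicator S s *\<^sub>R u n s)" for n
    using simple_function_compose2[OF simple_function_indicator[OF S] u(1), of "(*\<^sub>R)" n] by simp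
  then have "simple_function (lebesgue_on S) (u n)" for n
    using S by (simp add: simple_function_restrict_space)
  then show ?L using u(2) S by (auto simp: strongly_measurable_on_def AE_restrict_space_iff)
qed

lemma strongly_measurable_on_subset:
  assumes "strongly_measurable_on S f" "T \<subseteq> S" "S \<in> sets lebesgue" "T \<in> sets lebesgue"
  shows "strongly_measurable_on T f"
proof -
  obtain u where u: "\<And>n. simple_function lebesgue (u n)"
    "AE s in lebesgue. s \<in> S \<longrightarrow> (\<lambda>n. u n s) \<longlonglongrightarrow> f s"
    using assms strongly_measurable_on_iff by blast
  have "AE s in lebesgue. s \<in> T \<longrightarrow> (\<lambda>n. u n s) \<longlonglongrightarrow> f s"
    using u(2) by eventually_elim (use assms in auto)
  then show ?thesis using u(1) assms strongly_measurable_on_iff by blast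
qed

lemma strongly_measurable_on_Un:
  assumes "strongly_measurable_on S f" "strongly_measurable_on T f"
    and ST: "S \<in> sets lebesgue" "T \<in> sets lebesgue"
  shows "strongly_measurable_on (S \<union> T) f"
proof -
  obtain u where u: "\<And>n. simple_function lebesgue (u n)"
    "AE s in lebesgue. s \<in> S \<longrightarrow> (\<lambda>n. u n s) \<longlonglongrightarrow> f s"
    using assms strongly_measurable_on_iff by blast
  obtain v where v: "\<And>n. simple_function lebesgue (v n)"
    "AE s in lebesgue. s \<in> T \<longrightarrow> (\<lambda>n. v n s) \<longlonglongrightarrow> f s"
    using assms strongly_measurable_on_iff by blast
  define w where "w n s = (if s \<in> S then u n s else v n s)" for n s
  have "simple_function lebesgue (w n)" for n
    unfolding w_def using u(1) v(1) ST by (intro simple_function_If) auto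
  moreover have "AE s in lebesgue. s \<in> S \<union> T \<longrightarrow> (\<lambda>n. w n s) \<longlonglongrightarrow> f s"
    using u(2) v(2)
  proof eventually_elim
    case (elim s)
    then show ?case by (cases "s \<in> S") (simp_all add: w_def)
  qed
  ultimately show ?thesis using ST strongly_measurable_on_iff[of "S \<union> T" f] by blast
qed

lemma strongly_measurable_on_compose2:
  assumes "strongly_measurable_on S f" "strongly_measurable_on S g"
    and "continuous_on UNIV (\<lambda>(a, b). h a b)"
  shows "strongly_measurable_on S (\<lambda>s. h (f s) (g s))"
proof -
  obtain u where u: "\<And>n. simple_function (lebesgue_on S) (u n)"
    "AE s in lebesgue_on S. (\<lambda>n. u n s) \<longlonglongrightarrow> f s"
    using assms unfolding strongly_measurable_on_def by blast
  obtain v where v: "\<And>n. simple_function (lebesgue_on S) (v n)"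
    "AE s in lebesgue_on S. (\<lambda>n. v n s) \<longlonglongrightarrow> g s"
    using assms unfolding strongly_measurable_on_def by blast
  have "simple_function (lebesgue_on S) (\<lambda>s. h (u n s) (v n s))" for n
    using u(1) v(1) by (rule simple_function_compose2)
  moreover have "AE s in lebesgue_on S. (\<lambda>n. h (u n s) (v n s)) \<longlonglongrightarrow> h (f s) (g s)"
    using u(2) v(2)
  proof eventually_elim
    case (elim s)
    have "isCont (\<lambda>(a, b). h a b) (f s, g s)"
      using assms(3) by (simp add: continuous_on_eq_continuous_at)
    from isCont_tendsto_compose[OF this tendsto_Pair[OF elim]] show ?case by simp
  qed
  ultimately show ?thesis
    unfolding strongly_measurable_on_def by (intro exI[of _ "\<lambda>n s. h (u n s) (v n s)"]) simp
qed

lemma strongly_measurable_on_diff: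
  assumes "strongly_measurable_on S f" "strongly_measurable_on S g"
  shows "strongly_measurable_on S (\<lambda>s. f s - g s)"
  using assms by (rule strongly_measurable_on_compose2) (auto intro!: continuous_intros simp: split_beta)

lemma borel_measurable_norm_strongly_measurable_on:
  assumes "strongly_measurable_on S f" and S: "S \<in> sets lebesgue"
  shows "(\<lambda>s. norm (f s)) \<in> borel_measurable (lebesgue_on S)"
proof -
  obtain u where u: "\<And>n. simple_function (lebesgue_on S) (u n)"
    "AE s in lebesgue_on S. (\<lambda>n. u n s) \<longlonglongrightarrow> f s"
    using assms unfolding strongly_measurable_on_def by blast
  show ?thesis
  proof (rule borel_measurable_lebesgue_on_AE_limit[OF S])
    show "(\<lambda>s. norm (u n s)) \<in> borel_measurable (lebesgue_on S)" for n
      by (rule borel_measurable_simple_function[OF simple_function_compose1[OF u(1)]])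
    show "AE s in lebesgue_on S. (\<lambda>n. norm (u n s)) \<longlonglongrightarrow> norm (f s)"
      using u(2) by eventually_elim (rule tendsto_norm)
  qed
qed

lemma strongly_measurable_on_simple:
  "simple_function (lebesgue_on S) u \<Longrightarrow> strongly_measurable_on S u"
  unfolding strongly_measurable_on_def by (intro exI[of _ "\<lambda>_. u"]) simp

text \<open>The target space need not be separable, so limits of strongly measurable functions are not covered by
  a characterization through Borel sets. Instead a diagonal sequence is chosen: \<open>g n\<close> has a simple
  approximant \<open>w n\<close> with \<open>min 1 (norm (g n s - w n s))\<close> of integral below \<open>1 / (n + 1)\<close>, by dominated
  convergence on the finite measure space \<open>S\<close>; convergence to zero in mean then yields almost
  everywhere convergence along a subsequence.\<close>

lemma strongly_measurable_on_limit:
  fixes g :: "nat \<Rightarrow> real \<Rightarrow> 'a::real_normed_vector"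
  assumes S: "S \<in> lmeasurable"
    and g: "\<And>n. strongly_measurable_on S (g n)"
    and lim: "AE s in lebesgue_on S. (\<lambda>n. g n s) \<longlonglongrightarrow> h s"
  shows "strongly_measurable_on S h"
proof -
  interpret finite_measure "lebesgue_on S" by (rule finite_measure_lebesgue_on[OF S])
  have S': "S \<in> sets lebesgue" using S by (rule fmeasurableD)
  define d where "d n w s = min 1 (norm (g n s - w s))" for n and w :: "real \<Rightarrow> 'a" and s
  have d_meas: "d n w \<in> borel_measurable (lebesgue_on S)"
    if "simple_function (lebesgue_on S) w" for n w
    unfolding d_def
    using borel_measurable_norm_strongly_measurable_on[OF
        strongly_measurable_on_diff[OF g strongly_measurable_on_simple[OF that]] S', of n]
    by measurable
  have d_int: "integrable (lebesgue_on S) (d n w)"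
    if "simple_function (lebesgue_on S) w" for n w
    by (rule integrable_const_bound[where B = 1, OF _ d_meas[OF that]]) (simp add: d_def)
  have "\<exists>w. simple_function (lebesgue_on S) w \<and> (LINT s|lebesgue_on S. d n w s) < 1 / real (Suc n)" for n
  proof -
    obtain u where u: "\<And>k. simple_function (lebesgue_on S) (u k)"
      "AE s in lebesgue_on S. (\<lambda>k. u k s) \<longlonglongrightarrow> g n s"
      using g[of n] unfolding strongly_measurable_on_def by blast
    have "(\<lambda>k. LINT s|lebesgue_on S. d n (u k) s) \<longlonglongrightarrow> (LINT s|lebesgue_on S. 0)"
    proof (rule integral_dominated_convergence[where w = "\<lambda>_. 1"])
      show "AE s in lebesgue_on S. (\<lambda>k. d n (u k) s) \<longlonglongrightarrow> 0"
        using u(2)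
      proof eventually_elim
        case (elim s)
        have "(\<lambda>k. min 1 (norm (g n s - u k s))) \<longlonglongrightarrow> min 1 (norm (g n s - g n s))"
          by (intro tendsto_intros elim)
        then show ?case by (simp add: d_def)
      qed
      show "d n (u k) \<in> borel_measurable (lebesgue_on S)" for k by (rule d_meas[OF u(1)])
    qed (auto simp: d_def)
    then have "\<forall>\<^sub>F k in sequentially. (LINT s|lebesgue_on S. d n (u k) s) < 1 / real (Suc n)"
      by (intro order_tendstoD(2)[where y = 0]) auto
    then show ?thesis using u(1) by (auto simp: eventually_sequentially)
  qed
  then obtain w where w: "\<And>n. simple_function (lebesgue_on S) (w n)"
    "\<And>n. (LINT s|lebesgue_on S. d n (w n) s) < 1 / real (Suc n)" by metis
  have "(\<lambda>n. LINT s|lebesgue_on S. norm (d n (w n) s)) \<longlonglongrightarrow> 0"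
  proof (rule tendsto_sandwich[OF _ _ tendsto_const LIMSEQ_inverse_real_of_nat])
    show "\<forall>\<^sub>F n in sequentially. (LINT s|lebesgue_on S. norm (d n (w n) s)) \<le> inverse (real (Suc n))"
      using w(2) by (intro always_eventually allI) (simp add: d_def inverse_eq_divide less_imp_le)
  qed simp
  then obtain r where r: "strict_mono r" "AE s in lebesgue_on S. (\<lambda>n. d (r n) (w (r n)) s) \<longlonglongrightarrow> 0"
    using tendsto_L1_AE_subseq[of "lebesgue_on S" "\<lambda>n. d n (w n)"] d_int[OF w(1)] by blast
  have "AE s in lebesgue_on S. (\<lambda>n. w (r n) s) \<longlonglongrightarrow> h s"
    using r(2) lim
  proof eventually_elim
    case (elim s)
    have "\<forall>\<^sub>F n in sequentially. d (r n) (w (r n)) s < 1"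
      using order_tendstoD(2)[OF elim(1), of 1] by simp
    then have "\<forall>\<^sub>F n in sequentially. d (r n) (w (r n)) s = norm (g (r n) s - w (r n) s)"
      by eventually_elim (auto simp: d_def)
    with elim(1) have "(\<lambda>n. norm (g (r n) s - w (r n) s)) \<longlonglongrightarrow> 0"
      by (blast intro: Lim_transform_eventually)
    then have "(\<lambda>n. g (r n) s - w (r n) s) \<longlonglongrightarrow> 0" by (rule tendsto_norm_zero_cancel)
    moreover have "(\<lambda>n. g (r n) s) \<longlonglongrightarrow> h s"
      using LIMSEQ_subseq_LIMSEQ[OF elim(2) r(1)] by (simp add: o_def)
    ultimately have "(\<lambda>n. g (r n) s - (g (r n) s - w (r n) s)) \<longlonglongrightarrow> h s - 0"
      by (intro tendsto_diff)
    then show ?case by simp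
  qed
  then show ?thesis
    unfolding strongly_measurable_on_def using w(1) by (intro exI[of _ "\<lambda>n. w (r n)"]) simp
qed

lemma simple_function_superposition:
  assumes u: "simple_function M u" and v: "\<And>y. simple_function M (v y)"
  shows "simple_function M (\<lambda>s. v (u s) s)"
  unfolding simple_function_def
proof (intro conjI ballI)
  have sub: "(\<lambda>s. v (u s) s) ` space M \<subseteq> (\<Union>y\<in>u ` space M. v y ` space M)" by auto
  show "finite ((\<lambda>s. v (u s) s) ` space M)"
    by (rule finite_subset[OF sub]) (intro finite_UN_I simple_functionD(1) u v)
  fix z
  have "(\<lambda>s. v (u s) s) -` {z} \<inter> space M =
      (\<Union>y\<in>u ` space M. (u -` {y} \<inter> space M) \<inter> (v y -` {z} \<inter> space M))" by auto
  also have "\<dots> \<in> sets M"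
    by (intro sets.finite_UN sets.Int simple_functionD u v)
  finally show "(\<lambda>s. v (u s) s) -` {z} \<inter> space M \<in> sets M" .
qed

text \<open>Superposition with a Caratheodory function. Only the values of \<open>f\<close> at the finitely many values of a
  simple function enter its superposition with \<open>f\<close>, and continuity of \<open>f s\<close> passes to the limit.\<close>

lemma strongly_measurable_on_superposition:
  fixes f :: "real \<Rightarrow> 'b::real_normed_vector \<Rightarrow> 'a::real_normed_vector"
  assumes S: "S \<in> lmeasurable"
    and f: "\<And>y. strongly_measurable_on S (\<lambda>s. f s y)"
    and cont: "\<And>s. s \<in> S \<Longrightarrow> continuous_on UNIV (f s)"
    and x: "strongly_measurable_on S x"
  shows "strongly_measurable_on S (\<lambda>s. f s (x s))"
proof -
  obtain u where u: "\<And>n. simple_function (lebesgue_on S) (u n)"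
    "AE s in lebesgue_on S. (\<lambda>n. u n s) \<longlonglongrightarrow> x s"
    using x unfolding strongly_measurable_on_def by blast
  have "\<forall>y. \<exists>v. (\<forall>k. simple_function (lebesgue_on S) (v k)) \<and>
      (AE s in lebesgue_on S. (\<lambda>k. v k s) \<longlonglongrightarrow> f s y)"
    using f unfolding strongly_measurable_on_def by blast
  then obtain v where v: "\<And>y k. simple_function (lebesgue_on S) (v y k)"
    "\<And>y. AE s in lebesgue_on S. (\<lambda>k. v y k s) \<longlonglongrightarrow> f s y" by metis
  show ?thesis
  proof (rule strongly_measurable_on_limit[OF S])
    fix n
    have "finite (u n ` S)" using simple_functionD(1)[OF u(1)[of n]] by simp
    then have "AE s in lebesgue_on S. \<forall>y\<in>u n ` S. (\<lambda>k. v y k s) \<longlonglongrightarrow> f s y"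
      using v(2) by (subst AE_finite_all) auto
    moreover have "AE s in lebesgue_on S. s \<in> S" using AE_space[of "lebesgue_on S"] by simp
    ultimately have "AE s in lebesgue_on S. (\<lambda>k. v (u n s) k s) \<longlonglongrightarrow> f s (u n s)"
      by eventually_elim auto
    moreover have "simple_function (lebesgue_on S) (\<lambda>s. v (u n s) k s)" for k
      by (rule simple_function_superposition[OF u(1), of "\<lambda>y. v y k"]) (rule v(1))
    ultimately show "strongly_measurable_on S (\<lambda>s. f s (u n s))"
      unfolding strongly_measurable_on_def by (intro exI[of _ "\<lambda>k s. v (u n s) k s"]) simp
  next
    have "AE s in lebesgue_on S. s \<in> S" using AE_space[of "lebesgue_on S"] by simp
    then show "AE s in lebesgue_on S. (\<lambda>n. f s (u n s)) \<longlonglongrightarrow> f s (x s)"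
      using u(2)
    proof eventually_elim
      case (elim s)
      then have "isCont (f s) (x s)" using cont by (simp add: continuous_on_eq_continuous_at)
      then show ?case using elim(2) by (rule isCont_tendsto_compose)
    qed
  qed
qed

lemma lebesgue_distr_translation: "distr lebesgue lebesgue (\<lambda>s::real. t + s) = lebesgue"
  using lebesgue_real_affine[of 1 t, symmetric] by (simp add: density_1)

lemma measurable_lebesgue_translation: "(\<lambda>s::real. t + s) \<in> lebesgue \<rightarrow>\<^sub>M lebesgue"
  using lebesgue_affine_measurable[where c = "\<lambda>_::real. 1" and t = t] by simp

lemma AE_lebesgue_translation:
  fixes t :: real
  assumes "AE s in lebesgue. P s"
  shows "AE s in lebesgue. P (t + s)"
  by (rule AE_distrD[OF measurable_lebesgue_translation])
    (subst lebesgue_distr_translation, rule assms)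

lemma integrable_lebesgue_on_translation:
  fixes g :: "real \<Rightarrow> real"
  assumes S: "S \<in> sets lebesgue" "T \<in> sets lebesgue" and ST: "\<And>s. s \<in> T \<longleftrightarrow> t + s \<in> S"
    and g: "integrable (lebesgue_on S) g"
  shows "integrable (lebesgue_on T) (\<lambda>s. g (t + s))"
    and "(LINT s|lebesgue_on T. g (t + s)) = (LINT s|lebesgue_on S. g s)"
proof -
  let ?g = "\<lambda>s. if s \<in> S then g s else 0"
  have g': "integrable lebesgue ?g"
    using g S by (simp add: Lebesgue_Measure.integrable_restrict_UNIV)
  have eq: "(\<lambda>s. if s \<in> T then g (t + s) else 0) = (\<lambda>s. ?g (t + s))" using ST by auto
  have "integrable lebesgue (\<lambda>s. ?g (t + s))"
    by (rule integrable_distr[OF measurable_lebesgue_translation])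
      (subst lebesgue_distr_translation, rule g')
  then show "integrable (lebesgue_on T) (\<lambda>s. g (t + s))"
    using S by (simp add: Lebesgue_Measure.integrable_restrict_UNIV[symmetric] eq)
  have "integral\<^sup>L lebesgue (\<lambda>s. ?g (t + s)) = integral\<^sup>L (distr lebesgue lebesgue (\<lambda>s. t + s)) ?g"
    by (rule integral_distr[symmetric, OF measurable_lebesgue_translation])
      (rule borel_measurable_integrable[OF g'])
  also have "\<dots> = integral\<^sup>L lebesgue ?g" by (subst lebesgue_distr_translation) (rule HOL.refl)
  finally show "(LINT s|lebesgue_on T. g (t + s)) = (LINT s|lebesgue_on S. g s)"
    using S by (simp add: Lebesgue_Measure.integral_restrict_UNIV[symmetric] eq)
qed

lemma strongly_measurable_on_translation:
  fixes f :: "real \<Rightarrow> 'a::real_normed_vector"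
  assumes S: "S \<in> sets lebesgue" "T \<in> sets lebesgue" and ST: "\<And>s. s \<in> T \<longleftrightarrow> t + s \<in> S"
    and f: "strongly_measurable_on S f"
  shows "strongly_measurable_on T (\<lambda>s. f (t + s))"
proof -
  obtain u where u: "\<And>n. simple_function lebesgue (u n)"
    "AE s in lebesgue. s \<in> S \<longrightarrow> (\<lambda>n. u n s) \<longlonglongrightarrow> f s"
    using f S strongly_measurable_on_iff by blast
  have "simple_function lebesgue (\<lambda>s. u n (t + s))" for n
    using simple_function_comp[OF measurable_lebesgue_translation u(1)] by (simp add: o_def)
  moreover have "AE s in lebesgue. s \<in> T \<longrightarrow> (\<lambda>n. u n (t + s)) \<longlonglongrightarrow> f (t + s)"
    using AE_lebesgue_translation[OF u(2), of t] by (simp add: ST)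
  ultimately show ?thesis
    unfolding strongly_measurable_on_iff[OF S(2)] by (intro exI[of _ "\<lambda>n s. u n (t + s)"]) simp
qed

section \<open>Lebesgue and Stepanov spaces\<close>

text \<open>Powers \<open>norm _ powr p\<close> are integrated without taking roots. The following crude inequality then
  replaces Minkowski's.\<close>

lemma powr_add_le:
  fixes a b p :: real
  assumes "0 \<le> a" "0 \<le> b" "0 \<le> p"
  shows "(a + b) powr p \<le> 2 powr p * (a powr p + b powr p)"
proof -
  have "(a + b) powr p \<le> (2 * max a b) powr p"
    using assms by (intro powr_mono2) auto
  also have "\<dots> = 2 powr p * max a b powr p"
    using assms by (intro powr_mult) 
  also have "\<dots> \<le> 2 powr p * (a powr p + b powr p)"
    by (intro mult_left_mono) (auto simp: max_def)
  finally show ?thesis .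
qed

lemma powr_norm_diff_triangle:
  fixes a b c :: "'a::real_normed_vector"
  assumes "0 \<le> p"
  shows "norm (a - c) powr p \<le> 2 powr p * (norm (a - b) powr p + norm (b - c) powr p)"
proof -
  have "norm (a - c) powr p \<le> (norm (a - b) + norm (b - c)) powr p"
    using assms norm_triangle_ineq[of "a - b" "b - c"] by (intro powr_mono2) auto
  also have "\<dots> \<le> 2 powr p * (norm (a - b) powr p + norm (b - c) powr p)"
    using assms by (intro powr_add_le) auto
  finally show ?thesis .
qed

lemma Lp_norm_powr:
  assumes "1 \<le> p"
  shows "Lp_norm p S f powr p = (LINT s|lebesgue_on S. norm (f s) powr p)"
proof -
  have "0 \<le> (LINT s|lebesgue_on S. norm (f s) powr p)" by (rule Bochner_Integration.integral_nonneg) simp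
  then show ?thesis using assms by (simp add: Lp_norm_def powr_powr)
qed

lemma Lp_norm_nonneg: "0 \<le> Lp_norm p S f"
  by (simp add: Lp_norm_def)

lemma Lp_norm_le_iff:
  assumes "1 \<le> p" "0 \<le> B"
  shows "Lp_norm p S f \<le> B \<longleftrightarrow> (LINT s|lebesgue_on S. norm (f s) powr p) \<le> B powr p"
  using assms powr_mono2[of p "Lp_norm p S f" B] powr_less_mono2[of p B "Lp_norm p S f"]
    Lp_norm_nonneg[of p S f]
  by (subst Lp_norm_powr[OF assms(1), symmetric]) force

lemma borel_measurable_powr_norm:
  assumes "strongly_measurable_on S f" and "S \<in> sets lebesgue"
  shows "(\<lambda>s. norm (f s) powr p) \<in> borel_measurable (lebesgue_on S)"
  using borel_measurable_norm_strongly_measurable_on[OF assms] by measurable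

lemma Lp_spaceI_bound:
  assumes S: "S \<in> sets lebesgue" and f: "strongly_measurable_on S f"
    and g: "integrable (lebesgue_on S) g"
    and le: "AE s in lebesgue_on S. norm (f s) powr p \<le> g s"
  shows "f \<in> Lp_space p S"
proof -
  have "integrable (lebesgue_on S) (\<lambda>s. norm (f s) powr p)"
    using g borel_measurable_powr_norm[OF f S]
    by (rule Bochner_Integration.integrable_bound) (use le in eventually_elim, simp)
  then show ?thesis using f by (simp add: Lp_space_def)
qed

lemma Lp_space_diff:
  assumes "f \<in> Lp_space p S" "g \<in> Lp_space p S" "S \<in> sets lebesgue" "0 \<le> p"
  shows "(\<lambda>s. f s - g s) \<in> Lp_space p S"
proof (rule Lp_spaceI_bound)
  show "strongly_measurable_on S (\<lambda>s. f s - g s)"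
    using assms by (auto simp: Lp_space_def intro: strongly_measurable_on_diff)
  show "integrable (lebesgue_on S) (\<lambda>s. 2 powr p * (norm (f s) powr p + norm (g s) powr p))"
    using assms by (auto simp: Lp_space_def)
  show "AE s in lebesgue_on S.
      norm (f s - g s) powr p \<le> 2 powr p * (norm (f s) powr p + norm (g s) powr p)"
    using powr_norm_diff_triangle[OF assms(4), of _ _ 0] by (auto intro!: always_eventually)
qed fact

lemma Lp_space_subset:
  assumes "f \<in> Lp_space p S" "T \<subseteq> S" "S \<in> sets lebesgue" "T \<in> sets lebesgue"
  shows "f \<in> Lp_space p T"
proof -
  have "set_integrable lebesgue S (\<lambda>s. norm (f s) powr p)"
    using assms by (simp add: Lp_space_def set_integrable_def integrable_restrict_space)
  then have "set_integrable lebesgue T (\<lambda>s. norm (f s) powr p)"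
    by (rule set_integrable_subset) (use assms in auto)
  then show ?thesis
    using assms strongly_measurable_on_subset[of S f T]
    by (simp add: Lp_space_def set_integrable_def integrable_restrict_space)
qed

lemma Lp_space_Un:
  assumes "f \<in> Lp_space p S" "f \<in> Lp_space p T" "S \<in> sets lebesgue" "T \<in> sets lebesgue"
  shows "f \<in> Lp_space p (S \<union> T)"
proof -
  have "set_integrable lebesgue (S \<union> T) (\<lambda>s. norm (f s) powr p)"
    by (rule set_integrable_Un)
      (use assms in \<open>auto simp: Lp_space_def set_integrable_def integrable_restrict_space\<close>)
  then show ?thesis
    using assms strongly_measurable_on_Un[of S f T]
    by (simp add: Lp_space_def set_integrable_def integrable_restrict_space)
qed

lemma Lp_space_translation:
  assumes "S \<in> sets lebesgue" "T \<in> sets lebesgue" and "\<And>s. s \<in> T \<longleftrightarrow> t + s \<in> S"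
    and "f \<in> Lp_space p S"
  shows "(\<lambda>s. f (t + s)) \<in> Lp_space p T"
  using assms strongly_measurable_on_translation[OF assms(1-3), of f]
    integrable_lebesgue_on_translation(1)[OF assms(1-3), of "\<lambda>s. norm (f s) powr p"]
  by (simp add: Lp_space_def)

lemma bochner_transform_Lp_space_iff:
  "bochner_transform f t \<in> Lp_space p {0..1} \<longleftrightarrow> f \<in> Lp_space p {t..t+1}"
proof
  assume "f \<in> Lp_space p {t..t+1}"
  then show "bochner_transform f t \<in> Lp_space p {0..1}"
    using Lp_space_translation[of "{t..t+1}" "{0..1}" t f p] by (simp add: bochner_transform_def)
next
  assume "bochner_transform f t \<in> Lp_space p {0..1}"
  moreover have "s \<in> {t..t+1} \<longleftrightarrow> - t + s \<in> {0..1}" for s by auto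
  ultimately have "(\<lambda>s. bochner_transform f t (- t + s)) \<in> Lp_space p {t..t+1}"
    by (intro Lp_space_translation[of "{0..1}" "{t..t+1}"]) simp_all
  then show "f \<in> Lp_space p {t..t+1}" by (simp add: bochner_transform_def)
qed

lemma integral_unit_translation:
  fixes g :: "real \<Rightarrow> real"
  assumes "integrable (lebesgue_on {t..t+1}) g"
  shows "integrable (lebesgue_on {0..1}) (\<lambda>s. g (t + s))"
    and "(LINT s|lebesgue_on {0..1}. g (t + s)) = (LINT s|lebesgue_on {t..t+1}. g s)"
  using integrable_lebesgue_on_translation[OF _ _ _ assms, of "{0..1}" t] by auto

text \<open>A compact subset of \<open>I\<close> is covered by finitely many consecutive unit intervals that start in \<open>I\<close>.\<close>

lemma Lp_loc_iff_unit_intervals: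
  assumes I: "I = UNIV \<or> I = {0..}"
  shows "f \<in> Lp_loc p I \<longleftrightarrow> (\<forall>t\<in>I. f \<in> Lp_space p {t..t+1})"
proof
  assume "f \<in> Lp_loc p I"
  then show "\<forall>t\<in>I. f \<in> Lp_space p {t..t+1}" using I by (auto simp: Lp_loc_def)
next
  assume f: "\<forall>t\<in>I. f \<in> Lp_space p {t..t+1}"
  have long: "f \<in> Lp_space p {a..a + real n + 1}" if "a \<in> I" for a n
  proof (induction n)
    case 0
    then show ?case using f that by simp
  next
    case (Suc n)
    have "a + real (Suc n) \<in> I" using I that by auto
    then have "f \<in> Lp_space p ({a..a + real n + 1} \<union> {a + real (Suc n)..a + real (Suc n) + 1})"
      using Suc f by (intro Lp_space_Un) auto
    also have "{a..a + real n + 1} \<union> {a + real (Suc n)..a + real (Suc n) + 1} = {a..a + real (Suc n) + 1}"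
      by auto
    finally show ?case .
  qed
  show "f \<in> Lp_loc p I"
    unfolding Lp_loc_def
  proof (clarify)
    fix C assume C: "compact C" "C \<subseteq> I"
    then obtain B where B: "\<And>s. s \<in> C \<Longrightarrow> \<bar>s\<bar> \<le> B"
      using compact_imp_bounded[OF C(1)] by (auto simp: bounded_iff)
    define a where "a = (if I = UNIV then - B else 0)"
    obtain n where n: "B - a \<le> real n" using real_arch_simple by blast
    have "C \<subseteq> {a..a + real n + 1}"
    proof
      fix s assume "s \<in> C"
      then show "s \<in> {a..a + real n + 1}" using B[of s] n C(2) I by (auto simp: a_def split: if_splits)
    qed
    moreover have "a \<in> I" using I by (auto simp: a_def)
    ultimately show "f \<in> Lp_space p C"
      using long C(1) by (intro Lp_space_subset[of f p "{a..a + real n + 1}" C]) (auto simp: borel_compact)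
  qed
qed

lemma stepanov_space_iff:
  assumes I: "I = UNIV \<or> I = {0..}" and p: "1 \<le> p"
  shows "f \<in> stepanov_space (ereal p) I \<longleftrightarrow> (\<forall>t\<in>I. f \<in> Lp_space p {t..t+1}) \<and>
    (\<exists>B. \<forall>t\<in>I. (LINT s|lebesgue_on {t..t+1}. norm (f s) powr p) \<le> B)"
proof -
  have "stepanov_norm p I f < \<infinity> \<longleftrightarrow>
      (\<exists>B. \<forall>t\<in>I. (LINT s|lebesgue_on {t..t+1}. norm (f s) powr p) \<le> B)"
  proof
    assume fin: "stepanov_norm p I f < \<infinity>"
    have le: "ereal (Lp_norm p {t..t+1} f) \<le> stepanov_norm p I f" if "t \<in> I" for t
      unfolding stepanov_norm_def using that by (rule SUP_upper)
    have "0 \<in> I" using I by auto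
    from le[OF this] have "0 \<le> stepanov_norm p I f"
      using Lp_norm_nonneg[of p "{0..0+1}" f] by (meson ereal_less_eq(5) order_trans)
    then obtain B where B: "stepanov_norm p I f = ereal B" "0 \<le> B"
      using fin by (cases "stepanov_norm p I f") auto
    have "(LINT s|lebesgue_on {t..t+1}. norm (f s) powr p) \<le> B powr p" if "t \<in> I" for t
      using le[OF that] B p by (simp add: Lp_norm_le_iff)
    then show "\<exists>B. \<forall>t\<in>I. (LINT s|lebesgue_on {t..t+1}. norm (f s) powr p) \<le> B" by blast
  next
    assume "\<exists>B. \<forall>t\<in>I. (LINT s|lebesgue_on {t..t+1}. norm (f s) powr p) \<le> B"
    then obtain B where B: "\<And>t. t \<in> I \<Longrightarrow> (LINT s|lebesgue_on {t..t+1}. norm (f s) powr p) \<le> B"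
      by blast
    have "Lp_norm p {t..t+1} f \<le> max B 0 powr (1 / p)" if "t \<in> I" for t
    proof -
      have "(max B 0 powr (1 / p)) powr p = max B 0" using p by (simp add: powr_powr)
      then show ?thesis using B[OF that] p by (simp add: Lp_norm_le_iff)
    qed
    then have "stepanov_norm p I f \<le> ereal (max B 0 powr (1 / p))"
      unfolding stepanov_norm_def by (intro SUP_least) simp
    then show "stepanov_norm p I f < \<infinity>" by (metis ereal_infty_less_eq(1) ereal_less_PInfty order.strict_trans1 less_ereal.simps(4))
  qed
  then show ?thesis
    using Lp_loc_iff_unit_intervals[OF I, of f p] by (simp add: stepanov_space_def)
qed

section \<open>The gauge of a Bochner transform\<close>

text \<open>The \<open>p\<close>-th power of the distance between two values of the Bochner transform.\<close>

definition Lp_gauge :: "real \<Rightarrow> (real \<Rightarrow> 'a::real_normed_vector) \<Rightarrow> real \<Rightarrow> real \<Rightarrow> real" where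
  "Lp_gauge p f u v = (LINT s|lebesgue_on {0..1}. norm (f (u + s) - f (v + s)) powr p)"

lemma Lp_norm_bochner_transform_diff:
  "Lp_norm p {0..1} (bochner_transform f u - bochner_transform f v) = Lp_gauge p f u v powr (1 / p)"
  by (simp add: Lp_norm_def Lp_gauge_def bochner_transform_def fun_diff_def)

lemma Lp_gauge_nonneg: "0 \<le> Lp_gauge p f u v"
  unfolding Lp_gauge_def by (rule Bochner_Integration.integral_nonneg) simp

lemma Lp_gauge_eq_powr:
  assumes "1 \<le> p"
  shows "Lp_gauge p f u v = Lp_norm p {0..1} (bochner_transform f u - bochner_transform f v) powr p"
  using assms Lp_gauge_nonneg[of p f u v] by (simp add: Lp_norm_bochner_transform_diff powr_powr)

lemma Lp_gauge_integrable:
  assumes "f \<in> Lp_space p {u..u+1}" "f \<in> Lp_space p {v..v+1}" "0 \<le> p"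
  shows "integrable (lebesgue_on {0..1}) (\<lambda>s. norm (f (u + s) - f (v + s)) powr p)"
proof -
  have "(\<lambda>s. f (u + s) - f (v + s)) \<in> Lp_space p {0..1}"
    using assms by (intro Lp_space_diff)
      (simp_all add: bochner_transform_Lp_space_iff[unfolded bochner_transform_def])
  then show ?thesis by (simp add: Lp_space_def)
qed

lemma Lp_gauge_triangle:
  assumes "f \<in> Lp_space p {u..u+1}" "f \<in> Lp_space p {v..v+1}" "f \<in> Lp_space p {w..w+1}" "0 \<le> p"
  shows "Lp_gauge p f u w \<le> 2 powr p * (Lp_gauge p f u v + Lp_gauge p f v w)"
proof -
  have int: "integrable (lebesgue_on {0..1}) (\<lambda>s. norm (f (u + s) - f (v + s)) powr p)"
    "integrable (lebesgue_on {0..1}) (\<lambda>s. norm (f (v + s) - f (w + s)) powr p)"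
    "integrable (lebesgue_on {0..1}) (\<lambda>s. norm (f (u + s) - f (w + s)) powr p)"
    using assms by (auto intro: Lp_gauge_integrable)
  have "Lp_gauge p f u w \<le> (LINT s|lebesgue_on {0..1}. 2 powr p *
      (norm (f (u + s) - f (v + s)) powr p + norm (f (v + s) - f (w + s)) powr p))"
    unfolding Lp_gauge_def using int powr_norm_diff_triangle[OF assms(4)]
    by (intro integral_mono) auto
  also have "\<dots> = 2 powr p * (Lp_gauge p f u v + Lp_gauge p f v w)"
    unfolding Lp_gauge_def using int by simp
  finally show ?thesis .
qed

text \<open>A finite family of transforms with common almost periods forms one gauge, the sum of their gauges. The
  family is needed for the sections of a two-parameter function at the points of a finite net.\<close>

lemma almost_periodic_gauge_sum:
  assumes I: "I = UNIV \<or> I = {0..}" and p: "1 \<le> p" and Y: "finite Y"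
    and Lp: "\<And>t y. t \<in> I \<Longrightarrow> y \<in> Y \<Longrightarrow> g y \<in> Lp_space p {t..t+1}"
    and cont: "\<And>y. y \<in> Y \<Longrightarrow> continuous_wrt (Lp_norm p {0..1}) I (bochner_transform (g y))"
    and periods: "\<And>\<epsilon>. 0 < \<epsilon> \<Longrightarrow> \<exists>l>0. \<forall>a. {a..a+l} \<subseteq> I \<longrightarrow> (\<exists>\<tau>\<in>{a..a+l}. \<forall>t\<in>I. \<forall>y\<in>Y.
        Lp_norm p {0..1} (bochner_transform (g y) (t + \<tau>) - bochner_transform (g y) t) \<le> \<epsilon>)"
  shows "almost_periodic_gauge I (2 powr p) (\<lambda>u v. \<Sum>y\<in>Y. Lp_gauge p (g y) u v)"
proof
  show "I = UNIV \<or> I = {0..}" by fact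
  show "1 \<le> 2 powr p" using p by (intro ge_one_powr_ge_zero) auto
  show "(\<Sum>y\<in>Y. Lp_gauge p (g y) u u) = 0" for u by (simp add: Lp_gauge_def)
  show "(\<Sum>y\<in>Y. Lp_gauge p (g y) u v) = (\<Sum>y\<in>Y. Lp_gauge p (g y) v u)" for u v
    by (simp add: Lp_gauge_def norm_minus_commute)
  show "(\<Sum>y\<in>Y. Lp_gauge p (g y) u w) \<le>
      2 powr p * ((\<Sum>y\<in>Y. Lp_gauge p (g y) u v) + (\<Sum>y\<in>Y. Lp_gauge p (g y) v w))"
    if "u \<in> I" "v \<in> I" "w \<in> I" for u v w
    unfolding sum.distrib[symmetric] sum_distrib_left
    using that Lp p by (intro sum_mono Lp_gauge_triangle) auto
  show "((\<lambda>u. \<Sum>y\<in>Y. Lp_gauge p (g y) u a) \<longlongrightarrow> 0) (at a within I)" if "a \<in> I" for a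
  proof -
    have "((\<lambda>u. Lp_gauge p (g y) u a) \<longlongrightarrow> 0) (at a within I)" if "y \<in> Y" for y
    proof -
      have "((\<lambda>u. Lp_norm p {0..1} (bochner_transform (g y) u - bochner_transform (g y) a) powr p)
          \<longlongrightarrow> 0 powr p) (at a within I)"
        using cont[OF that] \<open>a \<in> I\<close> p unfolding continuous_wrt_def
        by (intro tendsto_powr') (auto simp: Lp_norm_nonneg)
      then show ?thesis using p by (simp add: Lp_gauge_eq_powr)
    qed
    then show ?thesis by (rule tendsto_null_sum)
  qed
  fix \<epsilon> :: real assume \<epsilon>: "0 < \<epsilon>"
  define e where "e = (\<epsilon> / (real (card Y) + 1)) powr (1 / p)"
  have e: "0 < e" using \<epsilon> by (simp add: e_def add_nonneg_eq_0_iff)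
  have ep: "e powr p = \<epsilon> / (real (card Y) + 1)" using \<epsilon> p by (simp add: e_def powr_powr)
  obtain l where l: "0 < l" "\<And>a. {a..a+l} \<subseteq> I \<Longrightarrow> \<exists>\<tau>\<in>{a..a+l}. \<forall>t\<in>I. \<forall>y\<in>Y.
        Lp_norm p {0..1} (bochner_transform (g y) (t + \<tau>) - bochner_transform (g y) t) \<le> e"
    using periods[OF e] by blast
  have "(\<Sum>y\<in>Y. Lp_gauge p (g y) (t + \<tau>) t) \<le> \<epsilon>"
    if "\<forall>y\<in>Y. Lp_norm p {0..1} (bochner_transform (g y) (t + \<tau>) - bochner_transform (g y) t) \<le> e" for t \<tau>
  proof -
    have "Lp_gauge p (g y) (t + \<tau>) t \<le> e powr p" if "y \<in> Y" for y
      using \<open>\<forall>y\<in>Y. _\<close> that p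
      by (subst Lp_gauge_eq_powr) (auto intro!: powr_mono2 simp: Lp_norm_nonneg)
    then have "(\<Sum>y\<in>Y. Lp_gauge p (g y) (t + \<tau>) t) \<le> real (card Y) * e powr p"
      by (rule sum_bounded_above)
    also have "\<dots> \<le> \<epsilon>" using \<epsilon> by (simp add: ep field_simps)
    finally show ?thesis .
  qed
  then show "\<exists>l>0. \<forall>a. {a..a+l} \<subseteq> I \<longrightarrow>
      (\<exists>\<tau>\<in>{a..a+l}. \<forall>t\<in>I. (\<Sum>y\<in>Y. Lp_gauge p (g y) (t + \<tau>) t) \<le> \<epsilon>)"
    using l by (intro exI[of _ l]) meson
qed

section \<open>The Lipschitz function as a multiplier\<close>

text \<open>A form of Young's inequality without its constants: with \<open>m\<close> the larger summand on the right,
  \<open>A \<le> m powr (1/r)\<close> and \<open>B \<le> m powr (1/q)\<close>, and the exponents add up to \<open>1/p\<close>.\<close>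

lemma powr_mult_le_add:
  fixes A B :: real
  assumes "0 \<le> A" "0 \<le> B" and pos: "0 < p" "0 < q" "0 < r" and pqr: "1 / p = 1 / q + 1 / r"
  shows "(A * B) powr p \<le> A powr r + B powr q"
proof -
  define m where "m = max (A powr r) (B powr q)"
  have "A = (A powr r) powr (1 / r)" "B = (B powr q) powr (1 / q)"
    using assms by (simp_all add: powr_powr)
  then have "A \<le> m powr (1 / r)" "B \<le> m powr (1 / q)"
    using pos by (metis m_def max.cobounded1 powr_ge_zero powr_mono2 divide_nonneg_pos zero_le_one less_imp_le,
        metis m_def max.cobounded2 powr_ge_zero powr_mono2 divide_nonneg_pos zero_le_one less_imp_le)
  then have "A * B \<le> m powr (1 / r) * m powr (1 / q)"
    using assms by (intro mult_mono) auto
  also have "\<dots> = m powr (1 / p)" by (simp add: pqr powr_add)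
  finally have "(A * B) powr p \<le> (m powr (1 / p)) powr p"
    using assms by (intro powr_mono2) auto
  also have "\<dots> = m" using pos by (simp add: powr_powr m_def le_max_iff_disj)
  also have "\<dots> \<le> A powr r + B powr q" by (simp add: m_def)
  finally show ?thesis .
qed

text \<open>Scaling \<open>A\<close> down and \<open>B\<close> up by the same factor makes the coefficient of \<open>A powr r\<close> as small as desired.\<close>

lemma powr_mult_le_weighted:
  fixes p q r \<epsilon> :: real
  assumes "0 < \<epsilon>" and pos: "0 < p" "0 < q" "0 < r" and pqr: "1 / p = 1 / q + 1 / r"
  obtains C where "0 \<le> C"
    "\<And>A B. 0 \<le> A \<Longrightarrow> 0 \<le> B \<Longrightarrow> (A * B) powr p \<le> \<epsilon> * A powr r + C * B powr q"
proof -
  define \<eta> where "\<eta> = \<epsilon> powr (1 / r)"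
  have \<eta>: "0 < \<eta>" "\<eta> powr r = \<epsilon>" using assms by (simp_all add: \<eta>_def powr_powr)
  show thesis
  proof (rule that)
    show "0 \<le> (1 / \<eta>) powr q" by simp
    fix A B :: real assume AB: "0 \<le> A" "0 \<le> B"
    have "(A * B) powr p = ((\<eta> * A) * ((1 / \<eta>) * B)) powr p" using \<eta> by simp
    also have "\<dots> \<le> (\<eta> * A) powr r + ((1 / \<eta>) * B) powr q"
      using AB \<eta> assms by (intro powr_mult_le_add) auto
    also have "\<dots> = \<epsilon> * A powr r + (1 / \<eta>) powr q * B powr q"
      using AB \<eta> by (simp only: powr_mult)
    finally show "(A * B) powr p \<le> \<epsilon> * A powr r + (1 / \<eta>) powr q * B powr q" .
  qed
qed

text \<open>The Lipschitz function \<open>L\<close> and the exponent \<open>r\<close> are traded for a weight \<open>H\<close> with a uniform bound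
  on its means over unit intervals. The weight \<open>H\<close> is \<open>\<bar>L\<bar> powr r\<close> for finite \<open>r\<close>, where the weighted Young inequality applies, and
  zero for \<open>r = \<infinity>\<close>, where \<open>p = q\<close> and \<open>L\<close> is essentially bounded. The final estimate takes the place
  of Hoelder's inequality: the first term is small in mean because \<open>\<epsilon>\<close> is, and the second when \<open>d\<close> is
  small in the mean of order \<open>q\<close>.\<close>

lemma stepanov_multiplier_weight:
  fixes L :: "real \<Rightarrow> real"
  assumes I: "I = UNIV \<or> I = {0..}" and p: "1 \<le> p" and q: "1 \<le> q" and r: "1 \<le> r"
    and pqr: "1 / ereal p = 1 / ereal q + 1 / r"
    and L: "(\<lambda>t. complex_of_real (L t)) \<in> stepanov_space r I"
    and L_nonneg: "\<And>t. t \<in> I \<Longrightarrow> 0 \<le> L t"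
  obtains H B where "\<And>s. 0 \<le> H s"
    and "\<And>t. t \<in> I \<Longrightarrow> integrable (lebesgue_on {t..t+1}) H"
    and "\<And>t. t \<in> I \<Longrightarrow> (LINT s|lebesgue_on {t..t+1}. H s) \<le> B"
    and "\<And>\<epsilon>. 0 < \<epsilon> \<Longrightarrow> \<exists>C\<ge>0. AE s in lebesgue. s \<in> I \<longrightarrow>
           (\<forall>d\<ge>0. (L s * d) powr p \<le> \<epsilon> * H s + C * d powr q)"
proof (cases "r = \<infinity>")
  case True
  have pq: "p = q" using pqr True p q by (simp add: one_ereal_def)
  have IL: "I \<in> sets lebesgue" using I by auto
  obtain M where M: "AE s in lebesgue. s \<in> I \<longrightarrow> \<bar>L s\<bar> \<le> M"
    using L True IL by (auto simp: stepanov_space_def Linf_space_def AE_restrict_space_iff)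
  show thesis
  proof (rule that[of "\<lambda>_. 0" 0])
    show "\<exists>C\<ge>0. AE s in lebesgue. s \<in> I \<longrightarrow> (\<forall>d\<ge>0. (L s * d) powr p \<le> \<epsilon> * 0 + C * d powr q)" for \<epsilon> :: real
    proof (intro exI[of _ "\<bar>M\<bar> powr p"] conjI)
      show "AE s in lebesgue. s \<in> I \<longrightarrow>
          (\<forall>d\<ge>0. (L s * d) powr p \<le> \<epsilon> * 0 + \<bar>M\<bar> powr p * d powr q)"
        using M
      proof eventually_elim
        case (elim s)
        show ?case
        proof (intro impI allI)
          fix d :: real assume s: "s \<in> I" and d: "0 \<le> d"
          have "(L s * d) powr p \<le> (\<bar>M\<bar> * d) powr p"
            using elim s d p L_nonneg[OF s] by (intro powr_mono2 mult_right_mono) auto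
          also have "\<dots> = \<bar>M\<bar> powr p * d powr q" using d pq by (simp add: powr_mult)
          finally show "(L s * d) powr p \<le> \<epsilon> * 0 + \<bar>M\<bar> powr p * d powr q" by simp
        qed
      qed
    qed simp
  qed auto
next
  case False
  then obtain r' where r': "r = ereal r'" "1 \<le> r'" using r by (cases r) (auto simp: one_ereal_def)
  have pqr': "1 / p = 1 / q + 1 / r'" using pqr r' p q by (simp add: one_ereal_def)
  define H where "H s = norm (complex_of_real (L s)) powr r'" for s
  have *: "\<forall>t\<in>I. (\<lambda>t. complex_of_real (L t)) \<in> Lp_space r' {t..t+1}"
    "\<exists>B. \<forall>t\<in>I. (LINT s|lebesgue_on {t..t+1}. H s) \<le> B"
    using L unfolding r'(1) stepanov_space_iff[OF I r'(2)] H_def by (rule conjunct1, rule conjunct2)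
  then obtain B where B: "\<And>t. t \<in> I \<Longrightarrow> (LINT s|lebesgue_on {t..t+1}. H s) \<le> B" by blast
  show thesis
  proof (rule that[of H B])
    show "integrable (lebesgue_on {t..t+1}) H" if "t \<in> I" for t
      using *(1) that unfolding Lp_space_def H_def[abs_def] by blast
    fix \<epsilon> :: real assume "0 < \<epsilon>"
    then obtain C where C: "0 \<le> C"
      "\<And>A B. 0 \<le> A \<Longrightarrow> 0 \<le> B \<Longrightarrow> (A * B) powr p \<le> \<epsilon> * A powr r' + C * B powr q"
      using powr_mult_le_weighted[of \<epsilon> p q r'] p q r'(2) pqr' by auto
    show "\<exists>C\<ge>0. AE s in lebesgue. s \<in> I \<longrightarrow> (\<forall>d\<ge>0. (L s * d) powr p \<le> \<epsilon> * H s + C * d powr q)"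
      using C L_nonneg by (intro exI[of _ C]) (auto simp: H_def intro!: always_eventually)
  qed (use B in \<open>auto simp: H_def\<close>)
qed

section \<open>Superposition with a Lipschitz function\<close>

lemma AE_unit_translation:
  fixes I :: "real set"
  assumes "AE s in lebesgue. s \<in> I \<longrightarrow> P s" "I = UNIV \<or> I = {0..}" "u \<in> I"
  shows "AE s in lebesgue_on {0..1}. P (u + s)"
proof -
  have "AE s in lebesgue. u + s \<in> I \<longrightarrow> P (u + s)"
    using AE_lebesgue_translation[OF assms(1)] .
  then have "AE s in lebesgue. s \<in> {0..1} \<longrightarrow> P (u + s)"
    by eventually_elim (use assms(2,3) in auto)
  then show ?thesis by (simp add: AE_restrict_space_iff)
qed

lemma measure_unit_interval: "Sigma_Algebra.measure (lebesgue_on {0..1}) {0..1::real} = 1"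
  by (simp add: measure_restrict_space)

text \<open>The context of the main estimates. The weight \<open>H\<close> of the previous section stands for the Lipschitz
  function, so that finite and infinite \<open>r\<close> need no distinction.\<close>

locale Lipschitz_superposition =
  fixes I :: "real set" and p q :: real
    and f :: "real \<Rightarrow> 'y::real_normed_vector \<Rightarrow> 'x::real_normed_vector"
    and x :: "real \<Rightarrow> 'y" and K :: "'y set"
    and L H :: "real \<Rightarrow> real" and B :: real
  assumes I: "I = UNIV \<or> I = {0..}" and p: "1 \<le> p" and q: "1 \<le> q"
    and f_stepanov: "\<And>y. (\<lambda>s. f s y) \<in> stepanov_space (ereal p) I"
    and L_nonneg: "\<And>t. t \<in> I \<Longrightarrow> 0 \<le> L t"
    and Lipschitz: "\<And>t u v. t \<in> I \<Longrightarrow> norm (f t u - f t v) \<le> L t * norm (u - v)"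
    and x_stepanov: "x \<in> stepanov_space (ereal q) I"
    and compact_K: "compact K"
    and x_in_K: "AE s in lebesgue. s \<in> I \<longrightarrow> x s \<in> K"
    and H_nonneg: "\<And>s. 0 \<le> H s"
    and H_integrable: "\<And>t. t \<in> I \<Longrightarrow> integrable (lebesgue_on {t..t+1}) H"
    and H_bound: "\<And>t. t \<in> I \<Longrightarrow> (LINT s|lebesgue_on {t..t+1}. H s) \<le> B"
    and weight: "\<And>\<epsilon>. 0 < \<epsilon> \<Longrightarrow> \<exists>C\<ge>0. AE s in lebesgue. s \<in> I \<longrightarrow>
           (\<forall>d\<ge>0. (L s * d) powr p \<le> \<epsilon> * H s + C * d powr q)"
begin

abbreviation h :: "real \<Rightarrow> 'x" where "h t \<equiv> f t (x t)"

lemma f_Lp: "t \<in> I \<Longrightarrow> (\<lambda>s. f s y) \<in> Lp_space p {t..t+1}"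
  using f_stepanov[of y] by (simp add: stepanov_space_iff[OF I p])

lemma x_Lp: "t \<in> I \<Longrightarrow> x \<in> Lp_space q {t..t+1}"
  using x_stepanov by (simp add: stepanov_space_iff[OF I q])

lemma interval_subset: "t \<in> I \<Longrightarrow> {t..t+1} \<subseteq> I"
  using I by auto

lemma continuous_f: "t \<in> I \<Longrightarrow> continuous_on UNIV (f t)"
proof -
  assume t: "t \<in> I"
  have "(L t)-lipschitz_on UNIV (f t)"
    using Lipschitz[OF t] L_nonneg[OF t] by (intro lipschitz_onI) (simp_all add: dist_norm)
  then show ?thesis by (rule lipschitz_on_continuous_on)
qed

lemma h_stepanov: "h \<in> stepanov_space (ereal p) I"
proof -
  obtain C where C: "0 \<le> C" "AE s in lebesgue. s \<in> I \<longrightarrow>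
      (\<forall>d\<ge>0. (L s * d) powr p \<le> 1 * H s + C * d powr q)"
    using weight[of 1] by auto
  define G where "G s = 2 powr p * (norm (f s 0) powr p + (H s + C * norm (x s) powr q))" for s
  obtain Bf where Bf: "\<And>t. t \<in> I \<Longrightarrow> (LINT s|lebesgue_on {t..t+1}. norm (f s 0) powr p) \<le> Bf"
    using f_stepanov[of 0, unfolded stepanov_space_iff[OF I p]] by blast
  obtain Bx where Bx: "\<And>t. t \<in> I \<Longrightarrow> (LINT s|lebesgue_on {t..t+1}. norm (x s) powr q) \<le> Bx"
    using x_stepanov[unfolded stepanov_space_iff[OF I q]] by blast
  have "h \<in> Lp_space p {t..t+1} \<and>
      (LINT s|lebesgue_on {t..t+1}. norm (h s) powr p) \<le> 2 powr p * (Bf + (B + C * Bx))"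
    if t: "t \<in> I" for t
  proof -
    have sm: "strongly_measurable_on {t..t+1} h"
    proof (rule strongly_measurable_on_superposition[where f = f and x = x])
      show "{t..t+1} \<in> lmeasurable" by simp
      show "strongly_measurable_on {t..t+1} (\<lambda>s. f s y)" for y
        using f_Lp[OF t, of y] by (simp add: Lp_space_def)
      show "continuous_on UNIV (f s)" if "s \<in> {t..t+1}" for s
        using that interval_subset[OF t] by (intro continuous_f) blast
      show "strongly_measurable_on {t..t+1} x" using x_Lp[OF t] by (simp add: Lp_space_def)
    qed
    have int: "integrable (lebesgue_on {t..t+1}) (\<lambda>s. norm (f s 0) powr p)"
      "integrable (lebesgue_on {t..t+1}) (\<lambda>s. norm (x s) powr q)"
      "integrable (lebesgue_on {t..t+1}) H"
      using f_Lp[OF t] x_Lp[OF t] H_integrable[OF t] by (auto simp: Lp_space_def)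
    have int_G: "integrable (lebesgue_on {t..t+1}) G" unfolding G_def using int by simp
    have "AE s in lebesgue. s \<in> {t..t+1} \<longrightarrow> norm (h s) powr p \<le> G s"
      using C(2)
    proof eventually_elim
      case (elim s)
      show ?case
      proof
        assume "s \<in> {t..t+1}"
        then have s: "s \<in> I" using interval_subset[OF t] by blast
        have "norm (h s) \<le> norm (f s 0) + norm (h s - f s 0)" by (rule norm_triangle_sub)
        also have "\<dots> \<le> norm (f s 0) + L s * norm (x s)"
          using Lipschitz[OF s, of "x s" 0] by simp
        finally have "norm (h s) powr p \<le> (norm (f s 0) + L s * norm (x s)) powr p"
          using p by (intro powr_mono2) auto
        also have "\<dots> \<le> 2 powr p * (norm (f s 0) powr p + (L s * norm (x s)) powr p)"
          using p L_nonneg[OF s] by (intro powr_add_le) auto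
        also have "\<dots> \<le> G s"
          unfolding G_def using elim s by (intro mult_left_mono add_left_mono) auto
        finally show "norm (h s) powr p \<le> G s" .
      qed
    qed
    then have le: "AE s in lebesgue_on {t..t+1}. norm (h s) powr p \<le> G s"
      by (simp add: AE_restrict_space_iff)
    have Lp: "h \<in> Lp_space p {t..t+1}"
      by (rule Lp_spaceI_bound[OF _ sm int_G le]) simp
    have "(LINT s|lebesgue_on {t..t+1}. norm (h s) powr p) \<le> (LINT s|lebesgue_on {t..t+1}. G s)"
      using Lp int_G le by (intro integral_mono_AE) (auto simp: Lp_space_def)
    also have "\<dots> = 2 powr p * ((LINT s|lebesgue_on {t..t+1}. norm (f s 0) powr p) +
        ((LINT s|lebesgue_on {t..t+1}. H s) + C * (LINT s|lebesgue_on {t..t+1}. norm (x s) powr q)))"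
      unfolding G_def using int by simp
    also have "\<dots> \<le> 2 powr p * (Bf + (B + C * Bx))"
      using Bf[OF t] Bx[OF t] H_bound[OF t] C(1) by (intro mult_left_mono add_mono) auto
    finally show ?thesis using Lp by blast
  qed
  then show ?thesis unfolding stepanov_space_iff[OF I p] by blast
qed

text \<open>The distance between \<open>h\<close> at two points is controlled by the distance between the values of \<open>x\<close> and the
  distances between the sections of \<open>f\<close> at the points of a \<open>\<rho>\<close>-net \<open>Y\<close> of \<open>K\<close>. Changing \<open>x u\<close> to \<open>x v\<close>
  in the second argument costs \<open>L u * norm (x u - x v)\<close>; replacing \<open>x v\<close> by a point of the net costs
  \<open>L u * \<rho>\<close>, and \<open>L v * \<rho>\<close> for the way back. The estimate holds for arbitrary pairs of points and hence
  serves continuity and almost periods alike.\<close>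

lemma gauge_h_estimate:
  assumes Y: "finite Y" and net: "K \<subseteq> (\<Union>y\<in>Y. cball y \<rho>)"
    and \<rho>: "0 \<le> \<rho>"
    and C: "0 \<le> C" "AE s in lebesgue. s \<in> I \<longrightarrow>
           (\<forall>d\<ge>0. (L s * d) powr p \<le> \<eta> * H s + C * d powr q)"
    and C1: "AE s in lebesgue. s \<in> I \<longrightarrow> (\<forall>d\<ge>0. (L s * d) powr p \<le> 1 * H s + C1 * d powr q)"
    and \<eta>: "0 \<le> \<eta>" and uv: "u \<in> I" "v \<in> I"
  shows "Lp_gauge p h u v \<le> 4 powr p * (\<eta> * B + C * Lp_gauge q x u v +
      (\<Sum>y\<in>Y. Lp_gauge p (\<lambda>s. f s y) u v) + 2 * \<rho> powr p * (B + C1))"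
proof -
  define G where "G s = 4 powr p * (\<eta> * H (u + s) + C * norm (x (u + s) - x (v + s)) powr q +
      (\<Sum>y\<in>Y. norm (f (u + s) y - f (v + s) y) powr p) +
      \<rho> powr p * (H (u + s) + C1) + \<rho> powr p * (H (v + s) + C1))" for s
  have int: "integrable (lebesgue_on {0..1}) (\<lambda>s. H (u + s))"
    "integrable (lebesgue_on {0..1}) (\<lambda>s. H (v + s))"
    "integrable (lebesgue_on {0..1}) (\<lambda>s. norm (x (u + s) - x (v + s)) powr q)"
    "\<And>y. integrable (lebesgue_on {0..1}) (\<lambda>s. norm (f (u + s) y - f (v + s) y) powr p)"
    "integrable (lebesgue_on {0..1::real}) (\<lambda>s. C1)"
    "integrable (lebesgue_on {0..1}) (\<lambda>s. norm (h (u + s) - h (v + s)) powr p)"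
  proof -
    show "integrable (lebesgue_on {0..1}) (\<lambda>s. H (u + s))" "integrable (lebesgue_on {0..1}) (\<lambda>s. H (v + s))"
      using H_integrable uv by (auto intro: integral_unit_translation(1))
    show "integrable (lebesgue_on {0..1}) (\<lambda>s. norm (x (u + s) - x (v + s)) powr q)"
      using x_Lp uv q by (intro Lp_gauge_integrable) auto
    show "integrable (lebesgue_on {0..1}) (\<lambda>s. norm (f (u + s) y - f (v + s) y) powr p)" for y
      using f_Lp uv p by (intro Lp_gauge_integrable[of "\<lambda>s. f s y"]) auto
    show "integrable (lebesgue_on {0..1::real}) (\<lambda>s. C1)"
      using finite_measure_lebesgue_on[of "{0..1::real}"] by (simp add: finite_measure.integrable_const)
    show "integrable (lebesgue_on {0..1}) (\<lambda>s. norm (h (u + s) - h (v + s)) powr p)"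
      using h_stepanov stepanov_space_iff[OF I p] uv p by (intro Lp_gauge_integrable[of h]) auto
  qed
  have "AE s in lebesgue_on {0..1}. norm (h (u + s) - h (v + s)) powr p \<le> G s"
    using AE_unit_translation[OF C(2) I uv(1)] AE_unit_translation[OF C1 I uv(1)]
      AE_unit_translation[OF C1 I uv(2)] AE_unit_translation[OF x_in_K I uv(2)]
      AE_space[of "lebesgue_on {0..1}"]
  proof eventually_elim
    case (elim s)
    let ?u = "u + s" and ?v = "v + s"
    have in_I: "?u \<in> I" "?v \<in> I" using uv I elim(5) by auto
    obtain y where y: "y \<in> Y" "norm (x ?v - y) \<le> \<rho>"
      using elim(4) net by (auto simp: dist_norm norm_minus_commute)
    let ?a = "L ?u * norm (x ?u - x ?v)" and ?b = "L ?u * \<rho>"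
      and ?c = "norm (f ?u y - f ?v y)" and ?d = "L ?v * \<rho>"
    have nonneg: "0 \<le> ?a" "0 \<le> ?b" "0 \<le> ?c" "0 \<le> ?d" using L_nonneg in_I \<rho> by auto
    have "norm (h ?u - f ?u (x ?v)) \<le> ?a" using Lipschitz in_I by blast
    moreover have "norm (f ?u (x ?v) - f ?u y) \<le> ?b" "norm (f ?v (x ?v) - f ?v y) \<le> ?d"
      using Lipschitz[OF in_I(1), of "x ?v" y] Lipschitz[OF in_I(2), of "x ?v" y] y(2)
        L_nonneg in_I by (meson mult_left_mono order_trans)+
    moreover have "h ?u - h ?v = (h ?u - f ?u (x ?v)) + (f ?u (x ?v) - f ?u y)
        + (f ?u y - f ?v y) + (f ?v y - f ?v (x ?v))" by simp
    ultimately have "norm (h ?u - h ?v) \<le> (?a + ?b) + (?c + ?d)"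
      using norm_triangle_ineq by (smt (verit) norm_minus_commute)
    then have "norm (h ?u - h ?v) powr p \<le> ((?a + ?b) + (?c + ?d)) powr p"
      using p by (intro powr_mono2) auto
    also have "\<dots> \<le> 2 powr p * ((?a + ?b) powr p + (?c + ?d) powr p)"
      using nonneg p by (intro powr_add_le) auto
    also have "\<dots> \<le> 2 powr p * (2 powr p * (?a powr p + ?b powr p) + 2 powr p * (?c powr p + ?d powr p))"
      using nonneg p by (intro mult_left_mono add_mono powr_add_le) auto
    also have "\<dots> = 4 powr p * (?a powr p + ?c powr p + ?b powr p + ?d powr p)"
      using powr_mult[of 2 2 p] by (simp add: algebra_simps)
    also have "\<dots> \<le> G s"
      unfolding G_def
    proof (intro mult_left_mono add_mono)
      show "?a powr p \<le> \<eta> * H ?u + C * norm (x ?u - x ?v) powr q" using elim(1) by simp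
      show "?c powr p \<le> (\<Sum>y\<in>Y. norm (f ?u y - f ?v y) powr p)"
        using y(1) Y by (intro member_le_sum[of y Y "\<lambda>y. norm (f ?u y - f ?v y) powr p"]) auto
      have "(L ?u * 1) powr p \<le> H ?u + C1" "(L ?v * 1) powr p \<le> H ?v + C1"
        using elim(2,3) by (metis mult_1 mult.right_neutral powr_one_eq_one zero_le_one)+
      then show "?b powr p \<le> \<rho> powr p * (H ?u + C1)" "?d powr p \<le> \<rho> powr p * (H ?v + C1)"
        using \<rho> L_nonneg in_I by (auto simp: powr_mult mult.commute intro!: mult_left_mono)
    qed auto
    finally show ?case .
  qed
  moreover have "integrable (lebesgue_on {0..1}) G" unfolding G_def using int by simp
  ultimately have "Lp_gauge p h u v \<le> (LINT s|lebesgue_on {0..1}. G s)"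
    unfolding Lp_gauge_def using int by (intro integral_mono_AE) auto
  also have "\<dots> = 4 powr p * (\<eta> * (LINT s|lebesgue_on {0..1}. H (u + s)) + C * Lp_gauge q x u v +
      (\<Sum>y\<in>Y. Lp_gauge p (\<lambda>s. f s y) u v) +
      \<rho> powr p * ((LINT s|lebesgue_on {0..1}. H (u + s)) + C1) +
      \<rho> powr p * ((LINT s|lebesgue_on {0..1}. H (v + s)) + C1))"
    unfolding G_def Lp_gauge_def using int by (simp add: measure_unit_interval)
  also have "\<dots> \<le> 4 powr p * (\<eta> * B + C * Lp_gauge q x u v +
      (\<Sum>y\<in>Y. Lp_gauge p (\<lambda>s. f s y) u v) + \<rho> powr p * (B + C1) + \<rho> powr p * (B + C1))"
    using H_bound[OF uv(1)] H_bound[OF uv(2)] \<eta> C(1)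
      integral_unit_translation(2)[OF H_integrable[OF uv(1)]]
      integral_unit_translation(2)[OF H_integrable[OF uv(2)]]
    by (intro mult_left_mono add_mono) auto
  finally show ?thesis by (simp add: algebra_simps)
qed

text \<open>The order of choices matters: \<open>\<eta>\<close> fixes the constant \<open>C\<close> of the weight, \<open>\<rho>\<close> fixes the net, and only then
  \<open>\<delta>\<close> is chosen, against \<open>C\<close>. Three of four equal parts of \<open>\<epsilon>\<close> are used up.\<close>

lemma gauge_h_small:
  assumes "0 < \<epsilon>"
  shows "\<exists>Y \<delta>. finite Y \<and> 0 < \<delta> \<and> (\<forall>u\<in>I. \<forall>v\<in>I.
    (\<Sum>y\<in>Y. Lp_gauge p (\<lambda>s. f s y) u v) \<le> \<delta> \<and> Lp_gauge q x u v \<le> \<delta> \<longrightarrow>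
    Lp_gauge p h u v \<le> \<epsilon>)"
proof -
  have "0 \<in> I" using I by auto
  have B: "0 \<le> B"
    by (rule order_trans[OF _ H_bound[OF \<open>0 \<in> I\<close>]])
      (rule Bochner_Integration.integral_nonneg, rule H_nonneg)
  define e where "e = \<epsilon> / (4 * 4 powr p)"
  have e: "0 < e" using assms by (simp add: e_def)
  obtain C1 where C1: "0 \<le> C1" "AE s in lebesgue. s \<in> I \<longrightarrow>
      (\<forall>d\<ge>0. (L s * d) powr p \<le> 1 * H s + C1 * d powr q)"
    using weight[of 1] by auto
  define \<eta> where "\<eta> = e / (B + 1)"
  have \<eta>: "0 < \<eta>" "\<eta> * B \<le> e" using e B by (auto simp: \<eta>_def field_simps)
  obtain C where C: "0 \<le> C" "AE s in lebesgue. s \<in> I \<longrightarrow>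
      (\<forall>d\<ge>0. (L s * d) powr p \<le> \<eta> * H s + C * d powr q)"
    using weight[OF \<eta>(1)] by auto
  define \<rho> where "\<rho> = (e / (2 * (B + C1 + 1))) powr (1 / p)"
  have \<rho>: "0 < \<rho>" using e B C1(1) by (simp add: \<rho>_def add_nonneg_eq_0_iff)
  have "\<rho> powr p = e / (2 * (B + C1 + 1))" using e B C1(1) p by (simp add: \<rho>_def powr_powr)
  then have "2 * \<rho> powr p * (B + C1) = e * ((B + C1) / (B + C1 + 1))"
    using B C1(1) by (simp add: field_simps)
  also have "\<dots> \<le> e * 1" using e B C1(1) by (intro mult_left_mono) auto
  finally have \<rho>p: "2 * \<rho> powr p * (B + C1) \<le> e" by simp
  define \<delta> where "\<delta> = e / (C + 1)"
  have \<delta>: "0 < \<delta>" using e C(1) by (simp add: \<delta>_def)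
  have "(C + 1) * \<delta> = e" using C(1) by (simp add: \<delta>_def)
  then have \<delta>_eq: "C * \<delta> + \<delta> = e" by (simp add: distrib_right)
  have "K \<subseteq> (\<Union>y\<in>K. ball y \<rho>)" using \<rho> by auto
  then obtain Y where Y: "finite Y" "K \<subseteq> (\<Union>y\<in>Y. ball y \<rho>)"
    by (rule compactE_image[OF compact_K open_ball])
  have net: "K \<subseteq> (\<Union>y\<in>Y. cball y \<rho>)"
    by (rule order_trans[OF Y(2) UN_mono]) auto
  show ?thesis
  proof (intro exI[of _ Y] exI[of _ \<delta>] conjI ballI impI Y(1) \<delta>; elim conjE)
    fix u v assume uv: "u \<in> I" "v \<in> I" and small: "(\<Sum>y\<in>Y. Lp_gauge p (\<lambda>s. f s y) u v) \<le> \<delta>"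
      "Lp_gauge q x u v \<le> \<delta>"
    have "Lp_gauge p h u v \<le> 4 powr p * (\<eta> * B + C * Lp_gauge q x u v +
      (\<Sum>y\<in>Y. Lp_gauge p (\<lambda>s. f s y) u v) + 2 * \<rho> powr p * (B + C1))"
      using gauge_h_estimate[OF Y(1) net _ C C1(2) _ uv] \<rho> \<eta>(1) by simp
    also have "\<dots> \<le> 4 powr p * (e + C * \<delta> + \<delta> + e)"
      using \<eta>(2) small C(1) \<rho>p by (intro mult_left_mono add_mono) auto
    also have "\<dots> = 4 powr p * (3 * e)" using \<delta>_eq by simp
    also have "\<dots> \<le> \<epsilon>" using assms by (simp add: e_def)
    finally show "Lp_gauge p h u v \<le> \<epsilon>" .
  qed
qed

lemma h_APS:
  assumes x: "almost_periodic_gauge I c (Lp_gauge q x)"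
    and f: "\<And>Y. finite Y \<Longrightarrow>
      almost_periodic_gauge I c' (\<lambda>u v. \<Sum>y\<in>Y. Lp_gauge p (\<lambda>s. f s y) u v)"
  shows "h \<in> APS p I"
proof -
  let ?N = "\<lambda>u v. Lp_norm p {0..1} (bochner_transform h u - bochner_transform h v)"
  let ?small = "\<lambda>\<epsilon> Y \<delta>. \<forall>u\<in>I. \<forall>v\<in>I.
    (\<Sum>y\<in>Y. Lp_gauge p (\<lambda>s. f s y) u v) \<le> \<delta> \<and> Lp_gauge q x u v \<le> \<delta> \<longrightarrow> ?N u v \<le> \<epsilon>"
  have small: "\<exists>Y \<delta>. finite Y \<and> 0 < \<delta> \<and> ?small \<epsilon> Y \<delta>"
    if \<epsilon>: "0 < \<epsilon>" for \<epsilon>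
  proof -
    have iff: "?N u v \<le> \<epsilon> \<longleftrightarrow> Lp_gauge p h u v \<le> \<epsilon> powr p" for u v
      using Lp_norm_le_iff[OF p less_imp_le[OF \<epsilon>], of "{0..1}"]
      by (simp add: Lp_gauge_def bochner_transform_def fun_diff_def)
    show ?thesis unfolding iff using \<epsilon> by (intro gauge_h_small) simp
  qed
  have "continuous_wrt (Lp_norm p {0..1}) I (bochner_transform h)"
    unfolding continuous_wrt_def
  proof (intro ballI tendstoI)
    fix a \<epsilon> :: real assume a: "a \<in> I" and \<epsilon>: "0 < \<epsilon>"
    from small[OF half_gt_zero[OF \<epsilon>]] obtain Y \<delta>
      where Y: "finite Y" "0 < \<delta>" "?small (\<epsilon> / 2) Y \<delta>" by (elim exE conjE)
    have "\<forall>\<^sub>F u in at a within I. (\<Sum>y\<in>Y. Lp_gauge p (\<lambda>s. f s y) u a) < \<delta>"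
      using order_tendstoD(2)[OF almost_periodic_gauge.continuous[OF f[OF Y(1)] a] Y(2)] .
    moreover have "\<forall>\<^sub>F u in at a within I. Lp_gauge q x u a < \<delta>"
      using order_tendstoD(2)[OF almost_periodic_gauge.continuous[OF x a] Y(2)] .
    moreover have "\<forall>\<^sub>F u in at a within I. u \<in> I" by (simp add: eventually_at_filter)
    ultimately show "\<forall>\<^sub>F u in at a within I. dist (?N u a) 0 < \<epsilon>"
    proof eventually_elim
      case (elim u)
      then have "?N u a \<le> \<epsilon> / 2" using Y(3) a by (simp add: less_imp_le)
      moreover have "0 \<le> ?N u a" by (rule Lp_norm_nonneg)
      ultimately show ?case using \<epsilon> unfolding dist_real_def by linarith
    qed
  qed
  moreover have "\<exists>l>0. \<forall>a. {a..a+l} \<subseteq> I \<longrightarrow> (\<exists>\<tau>\<in>{a..a+l}. \<forall>t\<in>I. ?N (t + \<tau>) t \<le> \<epsilon>)"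
    if \<epsilon>: "0 < \<epsilon>" for \<epsilon>
  proof -
    from small[OF \<epsilon>] obtain Y \<delta>
      where Y: "finite Y" "0 < \<delta>" "?small \<epsilon> Y \<delta>" by (elim exE conjE)
    obtain l where l: "0 < l" "\<And>a. {a..a+l} \<subseteq> I \<Longrightarrow> \<exists>\<omega>\<in>{a..a+l}. \<forall>t\<in>I.
        (\<Sum>y\<in>Y. Lp_gauge p (\<lambda>s. f s y) (t + \<omega>) t) \<le> \<delta> \<and> Lp_gauge q x (t + \<omega>) t \<le> \<delta>"
      using common_periods[OF f[OF Y(1)] x Y(2)] by blast
    show ?thesis
    proof (intro exI[of _ l] conjI allI impI l(1))
      fix a assume aI: "{a..a+l} \<subseteq> I"
      then obtain \<omega> where \<omega>: "\<omega> \<in> {a..a+l}" "\<forall>t\<in>I.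
        (\<Sum>y\<in>Y. Lp_gauge p (\<lambda>s. f s y) (t + \<omega>) t) \<le> \<delta> \<and> Lp_gauge q x (t + \<omega>) t \<le> \<delta>"
        using l(2) by blast
      have "t + \<omega> \<in> I" if "t \<in> I" for t using that \<omega>(1) aI I by auto
      then show "\<exists>\<tau>\<in>{a..a+l}. \<forall>t\<in>I. ?N (t + \<tau>) t \<le> \<epsilon>"
        using \<omega> Y(3) by (intro bexI[of _ \<omega>]) auto
    qed
  qed
  ultimately show ?thesis
    using h_stepanov by (simp add: APS_def almost_periodic_def)
qed

end

section \<open>Gauges of Stepanov almost periodic functions\<close>

lemma APS_gauge:
  assumes I: "I = UNIV \<or> I = {0..}" and q: "1 \<le> q" and x: "x \<in> APS q I"
  shows "almost_periodic_gauge I (2 powr q) (Lp_gauge q x)"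
proof -
  have "almost_periodic_gauge I (2 powr q) (\<lambda>u v. \<Sum>y\<in>{()}. Lp_gauge q x u v)"
    by (rule almost_periodic_gauge_sum[OF I q])
      (use x in \<open>auto simp: APS_def almost_periodic_def stepanov_space_iff[OF I q]\<close>)
  then show ?thesis by simp
qed

text \<open>Almost periods of a two-parameter function are uniform on compact sets, in particular on finite ones.\<close>

lemma APS2_gauge:
  assumes I: "I = UNIV \<or> I = {0..}" and p: "1 \<le> p" and f: "f \<in> APS2 p I" and Y: "finite Y"
  shows "almost_periodic_gauge I (2 powr p) (\<lambda>u v. \<Sum>y\<in>Y. Lp_gauge p (\<lambda>s. f s y) u v)"
proof (rule almost_periodic_gauge_sum[OF I p Y])
  show "(\<lambda>s. f s y) \<in> Lp_space p {t..t+1}" if "t \<in> I" for t y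
    using f that by (simp add: APS2_def bochner_transform_Lp_space_iff)
  show "continuous_wrt (Lp_norm p {0..1}) I (bochner_transform (\<lambda>s. f s y))" for y
    unfolding continuous_wrt_def
  proof
    fix a assume a: "a \<in> I"
    let ?F = "\<lambda>(t, y). bochner_transform (\<lambda>s. f s y) t"
    have "((\<lambda>z. Lp_norm p {0..1} (?F z - ?F (a, y))) \<longlongrightarrow> 0) (at (a, y) within I \<times> UNIV)"
      using f a by (simp add: APS2_def almost_periodic2_def continuous_wrt_def)
    moreover have "filterlim (\<lambda>u. (u, y)) (at (a, y) within I \<times> UNIV) (at a within I)"
      unfolding filterlim_at by (auto simp: eventually_at_filter intro!: tendsto_Pair)
    ultimately have "((\<lambda>u. Lp_norm p {0..1} (?F (u, y) - ?F (a, y))) \<longlongrightarrow> 0) (at a within I)"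
      by (rule filterlim_compose)
    then show "((\<lambda>u. Lp_norm p {0..1} (bochner_transform (\<lambda>s. f s y) u -
        bochner_transform (\<lambda>s. f s y) a)) \<longlongrightarrow> 0) (at a within I)" by simp
  qed
  show "\<exists>l>0. \<forall>a. {a..a+l} \<subseteq> I \<longrightarrow> (\<exists>\<tau>\<in>{a..a+l}. \<forall>t\<in>I. \<forall>y\<in>Y.
      Lp_norm p {0..1} (bochner_transform (\<lambda>s. f s y) (t + \<tau>) - bochner_transform (\<lambda>s. f s y) t) \<le> \<epsilon>)"
    if "0 < \<epsilon>" for \<epsilon>
    using f that finite_imp_compact[OF Y] by (simp add: APS2_def almost_periodic2_def)
qed

lemma APS2_section_stepanov:
  assumes I: "I = UNIV \<or> I = {0..}" and p: "1 \<le> p" and f: "f \<in> APS2 p I"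
  shows "(\<lambda>s. f s y) \<in> stepanov_space (ereal p) I"
proof -
  have Lp: "(\<lambda>s. f s y) \<in> Lp_space p {t..t+1}" if "t \<in> I" for t
    using f that by (simp add: APS2_def bochner_transform_Lp_space_iff)
  have "almost_periodic2 (Lp_norm p {0..1}) I (\<lambda>t y. bochner_transform (\<lambda>s. f s y) t)"
    using f by (simp add: APS2_def)
  then have "\<exists>B. \<forall>t\<in>I. \<forall>y. Lp_norm p {0..1} (bochner_transform (\<lambda>s. f s y) t) \<le> B"
    unfolding almost_periodic2_def by (rule conjunct1)
  then obtain B where B: "\<And>t. t \<in> I \<Longrightarrow> Lp_norm p {0..1} (bochner_transform (\<lambda>s. f s y) t) \<le> B"
    by blast
  have "(LINT s|lebesgue_on {t..t+1}. norm (f s y) powr p) \<le> B powr p" if "t \<in> I" for t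
  proof -
    have "integrable (lebesgue_on {t..t+1}) (\<lambda>s. norm (f s y) powr p)"
      using Lp[OF that] by (simp add: Lp_space_def)
    from integral_unit_translation(2)[OF this]
    have "(LINT s|lebesgue_on {t..t+1}. norm (f s y) powr p) =
        Lp_norm p {0..1} (bochner_transform (\<lambda>s. f s y) t) powr p"
      by (simp add: Lp_norm_powr[OF p] bochner_transform_def)
    also have "\<dots> \<le> B powr p" using B[OF that] p by (intro powr_mono2) (auto simp: Lp_norm_nonneg)
    finally show ?thesis .
  qed
  then show ?thesis unfolding stepanov_space_iff[OF I p] using Lp by blast
qed

section \<open>The composition theorem\<close>

theorem theorem2p1:
  fixes I :: "real set" and p q :: real and r :: ereal
    and f :: "real \<Rightarrow> 'y::complex_banach \<Rightarrow> 'x::complex_banach"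
    and x :: "real \<Rightarrow> 'y"
  assumes X_nontrivial: "\<exists>v::'x. v \<noteq> 0"
    and Y_nontrivial: "\<exists>v::'y. v \<noteq> 0"
    and I: "I = UNIV \<or> I = {0..}"
    and p: "1 \<le> p" and q: "1 \<le> q" and r: "1 \<le> r"
    and pqr: "1 / ereal p = 1 / ereal q + 1 / r"
    and f_APS: "f \<in> APS2 p I"
    and f_Lipschitz:
      "\<exists>L :: real \<Rightarrow> real. (\<lambda>t. complex_of_real (L t)) \<in> stepanov_space r I \<and>
         (\<forall>t\<in>I. \<forall>u v. norm (f t u - f t v) \<le> L t * norm (u - v))"
    and x_APS: "x \<in> APS q I"
    and x_range:
      "\<exists>E. E \<subseteq> I \<and> E \<in> null_sets lebesgue \<and> compact (closure (x ` (I - E)))"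
  shows "(\<lambda>t. f t (x t)) \<in> APS p I"
proof -
  obtain L :: "real \<Rightarrow> real" where L: "(\<lambda>t. complex_of_real (L t)) \<in> stepanov_space r I"
    "\<And>t u v. t \<in> I \<Longrightarrow> norm (f t u - f t v) \<le> L t * norm (u - v)"
    using f_Lipschitz by blast
  obtain E where E: "E \<in> null_sets lebesgue" "compact (closure (x ` (I - E)))"
    using x_range by blast
  \<comment> \<open>A Lipschitz constant is nonnegative as soon as there are two distinct points.\<close>
  have L_nonneg: "0 \<le> L t" if "t \<in> I" for t
  proof -
    obtain w :: 'y where "w \<noteq> 0" using Y_nontrivial by blast
    moreover have "0 \<le> L t * norm (w - 0)" using L(2)[OF that, of w 0] norm_ge_zero order_trans by blast
    ultimately show ?thesis by (simp add: zero_le_mult_iff)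
  qed
  obtain H B where H: "\<And>s. 0 \<le> H s"
    "\<And>t. t \<in> I \<Longrightarrow> integrable (lebesgue_on {t..t+1}) H"
    "\<And>t. t \<in> I \<Longrightarrow> (LINT s|lebesgue_on {t..t+1}. H s) \<le> B"
    "\<And>\<epsilon>. 0 < \<epsilon> \<Longrightarrow> \<exists>C\<ge>0. AE s in lebesgue. s \<in> I \<longrightarrow>
           (\<forall>d\<ge>0. (L s * d) powr p \<le> \<epsilon> * H s + C * d powr q)"
    using stepanov_multiplier_weight[OF I p q r pqr L(1) L_nonneg] by blast
  have "AE s in lebesgue. s \<notin> E" using E(1) by (rule AE_not_in)
  then have x_in: "AE s in lebesgue. s \<in> I \<longrightarrow> x s \<in> closure (x ` (I - E))"
    by eventually_elim (auto intro!: closure_subset[THEN subsetD])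
  interpret Lipschitz_superposition I p q f x "closure (x ` (I - E))" L H B
    using I p q APS2_section_stepanov[OF I p f_APS] L_nonneg L(2) x_APS E(2) x_in H
    by unfold_locales (simp_all add: APS_def)
  show ?thesis
    using APS_gauge[OF I q x_APS] APS2_gauge[OF I p f_APS] by (rule h_APS)
qed

end
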